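(* Let $K$ be an imaginary quadratic field and let $D$ satisfy $H(D,\Delta)=1$. Then an oriented circle $C$ belongs to $\mathcal{S}_D$ if and only if $C=M\widehat{\mathbb{R}}$ for some $M\in\mathrm{PGL}_2(K)$ with $|\det M|/\|(M)\|=\sqrt{D}$.
   Context: $K$ is an imaginary quadratic field with ring of integers $\mathcal{O}$ and discriminant $\Delta<0$; $\sqrt{\Delta}=i\sqrt{|\Delta|}$. $H(a,b)=1$ if $ax^2+by^2=z^2$ has a nonzero rational solution and $-1$ otherwise. An oriented circle $C$ is determined by $\zeta\in\mathbb{C}$, $r,\hat r\in\mathbb{R}$ with $|\zeta|^2-r\hat r=1$; as a point set $C=\{\alpha/\beta\in\widehat{\mathbb{C}}: r|\alpha|^2-2\Re(\overline{\alpha}\beta\zeta)+\hat r|\beta|^2=0\}$; $r$ is the curvature, $\zeta$ the curvature-center, $\hat r$ the cocurvature, $\mathbf{v}_C=[\zeta\;\overline{\zeta}\;\hat r\;r]$. For $D\in\mathbb{R}$, $\mathcal{S}_D$ is the set of oriented circles with $i\sqrt{D}\,\mathbf{v}_C\in\mathcal{O}^2\times\sqrt{\Delta}\mathbb{Z}^2$. For $M=\begin{bmatrix}\alpha&\gamma\\ \beta&\delta\end{bmatrix}\in\mathrm{PGL}_2(K)$, $M\widehat{\mathbb{R}}$ denotes the oriented circle with curvature-center $i(\alpha\overline{\delta}-\overline{\beta}\gamma)/|\det M|$, cocurvature $i(\alpha\overline{\gamma}-\overline{\alpha}\gamma)/|\det M|$ and curvature $i(\beta\overline{\delta}-\overline{\beta}\delta)/|\det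 M|$ (the image of the real line, oriented with interior the upper half-plane, under the Möbius map $M$). $(M)$ denotes the fractional ideal of $K$ generated by the four entries of $M$ and $\|(M)\|$ its norm; the quantity $|\det M|/\|(M)\|$ does not depend on the representative of $M$.
   Formalization: The formal theorem also assumes D ≠ 0: for D = 0 the stated formula gives H(0,Δ) = 1 and S_0 contains every oriented circle, but no M in PGL_2(K) has |det M|/‖(M)‖ = 0, so the claim fails there. *)

theory Defs
  imports "HOL-Analysis.Analysis" "HOL-Computational_Algebra.Polynomial"
begin

definition subfield_of_complex :: "complex set \<Rightarrow> bool" where
  "subfield_of_complex K \<longleftrightarrow>
     0 \<in> K \<and> 1 \<in> K \<and> (\<forall>x\<in>K. \<forall>y\<in>K. x - y \<in> K \<and> x * y \<in> K) \<and> (\<forall>x\<in>K. inverse x \<in> K)"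

text \<open>
  Imaginary quadratic fields are taken with a fixed embedding in the complex numbers: subfields of
  degree 2 over the rationals that are not contained in the reals. (The value 2 of \<^term>\<open>dim\<close>
  excludes infinite degree, for which \<^term>\<open>dim\<close> is 0.)
\<close>

definition imaginary_quadratic_field :: "complex set \<Rightarrow> bool" where
  "imaginary_quadratic_field K \<longleftrightarrow>
     subfield_of_complex K \<and>
     vector_space.dim (\<lambda>(q::rat) (z::complex). of_rat q * z) K = 2 \<and>
     \<not> K \<subseteq> \<real>"

definition ring_of_integers :: "complex set \<Rightarrow> complex set" where
  "ring_of_integers K = {x \<in> K. algebraic_int x}"

definition integral_basis :: "complex set \<Rightarrow> complex \<Rightarrow> complex \<Rightarrow> bool" where
  "integral_basis K w1 w2 \<longleftrightarrow>
     ring_of_integers K = {of_int m * w1 + of_int n * w2 | m n. True} \<and>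
     (\<forall>m n. of_int m * w1 + of_int n * w2 = 0 \<longrightarrow> m = 0 \<and> n = 0)"

text \<open>
  The squared determinant of the matrix of conjugates of an integral basis; the two embeddings of
  an imaginary quadratic field are the inclusion and complex conjugation.
\<close>

definition field_discriminant :: "complex set \<Rightarrow> int" where
  "field_discriminant K =
     (THE d. \<exists>w1 w2. integral_basis K w1 w2 \<and> of_int d = (w1 * cnj w2 - w2 * cnj w1)\<^sup>2)"

definition sqrt_discriminant :: "complex set \<Rightarrow> complex" where
  "sqrt_discriminant K = \<i> * of_real (sqrt \<bar>of_int (field_discriminant K)\<bar>)"

text \<open>The coefficients may be arbitrary reals, but the solutions must be rational.\<close>

definition hilbert_symbol :: "real \<Rightarrow> real \<Rightarrow> int" where
  "hilbert_symbol a b =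
     (if \<exists>x y z :: rat. (x, y, z) \<noteq> (0, 0, 0) \<and>
           a * (of_rat x)\<^sup>2 + b * (of_rat y)\<^sup>2 = (of_rat z)\<^sup>2
      then 1 else -1)"

text \<open>
  An oriented circle is determined by its three parameters (negating all of them reverses the
  orientation), so it is represented by them.
\<close>

record circle_params =
  curvature_center :: complex
  cocurvature :: real
  curvature :: real

definition oriented_circles :: "circle_params set" where
  "oriented_circles =
     {C. (cmod (curvature_center C))\<^sup>2 - curvature C * cocurvature C = 1}"

definition circle_vector :: "circle_params \<Rightarrow> complex \<times> complex \<times> complex \<times> complex" where
  "circle_vector C =
     (curvature_center C, cnj (curvature_center C), of_real (cocurvature C), of_real (curvature C))"

text \<open>
  The complex root \<^const>\<open>csqrt\<close> is used because \<open>D\<close> ranges over all real numbers.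
\<close>

definition circle_family :: "complex set \<Rightarrow> real \<Rightarrow> circle_params set" where
  "circle_family K D =
     {C \<in> oriented_circles.
        (let s = \<i> * csqrt (of_real D);
             L = {sqrt_discriminant K * of_int n | n. True};
             (v1, v2, v3, v4) = circle_vector C
         in (s * v1, s * v2, s * v3, s * v4)
              \<in> ring_of_integers K \<times> ring_of_integers K \<times> L \<times> L)}"

definition GL2 :: "complex set \<Rightarrow> (complex^2^2) set" where
  "GL2 K = {M. (\<forall>i j. M $ i $ j \<in> K) \<and> det M \<noteq> 0}"

definition proportional :: "complex set \<Rightarrow> ((complex^2^2) \<times> (complex^2^2)) set" where
  "proportional K =
     {(M, N). M \<in> GL2 K \<and> N \<in> GL2 K \<and> (\<exists>c\<in>K. c \<noteq> 0 \<and> N = (\<chi> i j. c * M $ i $ j))}"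

definition PGL2 :: "complex set \<Rightarrow> (complex^2^2) set set" where
  "PGL2 K = GL2 K // proportional K"

text \<open>
  With rows \<open>(\<alpha>, \<gamma>)\<close> and \<open>(\<beta>, \<delta>)\<close>, so that \<open>\<infinity>\<close> is sent to \<open>\<alpha>/\<beta>\<close> and \<open>0\<close> to \<open>\<gamma>/\<delta>\<close>.
  The arguments of \<^const>\<open>Re\<close> are real numbers.
\<close>

definition image_of_real_line :: "complex^2^2 \<Rightarrow> circle_params" where
  "image_of_real_line M =
     (let \<alpha> = M $ 1 $ 1; \<gamma> = M $ 1 $ 2; \<beta> = M $ 2 $ 1; \<delta> = M $ 2 $ 2
      in \<lparr> curvature_center = \<i> * (\<alpha> * cnj \<delta> - cnj \<beta> * \<gamma>) / of_real (cmod (det M)),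
           cocurvature = Re (\<i> * (\<alpha> * cnj \<gamma> - cnj \<alpha> * \<gamma>) / of_real (cmod (det M))),
           curvature = Re (\<i> * (\<beta> * cnj \<delta> - cnj \<beta> * \<delta>) / of_real (cmod (det M))) \<rparr>)"

definition entries_ideal :: "complex set \<Rightarrow> complex^2^2 \<Rightarrow> complex set" where
  "entries_ideal K M =
     {\<Sum>i\<in>UNIV. \<Sum>j\<in>UNIV. A $ i $ j * M $ i $ j | A. \<forall>i j. A $ i $ j \<in> ring_of_integers K}"

definition integral_ideal_norm :: "complex set \<Rightarrow> complex set \<Rightarrow> nat" where
  "integral_ideal_norm K J =
     card (ring_of_integers K //
       {(x, y). x \<in> ring_of_integers K \<and> y \<in> ring_of_integers K \<and> x - y \<in> J})"

text \<open>
  A nonzero fractional ideal \<open>I\<close> has norm \<open>N(dI) / N(d)\<close> for any common denominator \<open>d\<close>, where the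
  norm of the field element \<open>d\<close> is \<open>d\<close> times its complex conjugate.
\<close>

definition ideal_norm :: "complex set \<Rightarrow> complex set \<Rightarrow> real" where
  "ideal_norm K I =
     (THE q. \<exists>d\<in>ring_of_integers K. d \<noteq> 0 \<and> (*) d ` I \<subseteq> ring_of_integers K \<and>
        q = real (integral_ideal_norm K ((*) d ` I)) / (cmod d)\<^sup>2)"

lemma image_of_real_line_scale:
  assumes "c \<noteq> 0"
  shows "image_of_real_line (\<chi> i j. c * M $ i $ j) = image_of_real_line M"
proof -
  have d: "det (\<chi> i j. c * M $ i $ j) = c\<^sup>2 * det M"
    by (simp add: det_2 algebra_simps power2_eq_square)
  have c2: "of_real ((cmod c)\<^sup>2) = c * cnj c"
    by (simp only: complex_norm_square)
  have eq: "\<i> * (c * x * cnj (c * y) - cnj (c * u) * (c * v)) / of_real (cmod (c\<^sup>2 * det M))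
      = \<i> * (x * cnj y - cnj u * v) / of_real (cmod (det M))" for x y u v
  proof -
    have "\<i> * (c * x * cnj (c * y) - cnj (c * u) * (c * v))
        = of_real ((cmod c)\<^sup>2) * (\<i> * (x * cnj y - cnj u * v))"
      unfolding c2 by (simp add: algebra_simps)
    moreover have "complex_of_real (cmod (c\<^sup>2 * det M))
        = of_real ((cmod c)\<^sup>2) * of_real (cmod (det M))"
      by (simp add: norm_mult norm_power)
    moreover have "complex_of_real ((cmod c)\<^sup>2) \<noteq> 0"
      using assms by simp
    ultimately show ?thesis
      by (metis mult_divide_mult_cancel_left)
  qed
  show ?thesis
    unfolding image_of_real_line_def Let_def d vec_lambda_beta eq ..
qed

lemma image_of_real_line_in_oriented_circles:
  assumes "det M \<noteq> 0"
  shows "image_of_real_line M \<in> oriented_circles"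
proof -
  define q where "q = cmod (det M)"
  define a b c d where "a = M $ 1 $ 1" "b = M $ 2 $ 1" "c = M $ 1 $ 2" "d = M $ 2 $ 2"
  have q: "q \<noteq> 0" "q\<^sup>2 = (cmod (a * d - c * b))\<^sup>2"
    using assms by (simp_all add: q_def det_2 a_b_c_d_def)
  have main: "(cmod (a * cnj d - cnj b * c))\<^sup>2 -
      Re (\<i> * (b * cnj d - cnj b * d)) * Re (\<i> * (a * cnj c - cnj a * c)) = q\<^sup>2"
    unfolding q(2) cmod_power2 by (simp add: algebra_simps power2_eq_square)
  have "(cmod (\<i> * (a * cnj d - cnj b * c) / of_real q))\<^sup>2 -
      Re (\<i> * (b * cnj d - cnj b * d) / of_real q) * Re (\<i> * (a * cnj c - cnj a * c) / of_real q)
      = ((cmod (a * cnj d - cnj b * c))\<^sup>2 -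
      Re (\<i> * (b * cnj d - cnj b * d)) * Re (\<i> * (a * cnj c - cnj a * c))) / q\<^sup>2"
    unfolding norm_divide norm_mult Re_divide_of_real
    using q(1) by (simp add: field_simps power2_eq_square)
  also have "\<dots> = 1"
    unfolding main using q(1) by simp
  finally show ?thesis
    unfolding oriented_circles_def image_of_real_line_def Let_def q_def a_b_c_d_def
    by (simp only: mem_Collect_eq circle_params.simps)
qed

end

theory Submission
  imports Defs
begin

text \<open>
  Scaled by \<open>- \<i> * sqrt D\<close>, the parameters of a circle \<open>C\<close> in the family \<open>S\<^sub>D\<close> form a skew-Hermitian
  matrix \<open>A\<close> over \<open>\<O>\<close> with diagonal in \<open>sqrt \<Delta> * \<int>\<close> and determinant \<open>D\<close>, and \<open>C\<close> is the image of the
  real line under the matrix with columns \<open>u\<close>, \<open>v\<close> as soon as \<open>u v* - v u* = N A\<close> with \<open>N > 0\<close>; the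
  absolute value of the determinant is then \<open>N * sqrt D\<close>. So one needs such a pair for which \<open>N\<close> is
  the norm of the ideal of the entries. As \<open>D\<close> is a norm from \<open>K\<close>, the form \<open>A\<close> has an isotropic vector
  \<open>u = (\<alpha>, \<beta>)\<close> over \<open>K\<close>. Let \<open>I = (\<alpha>, \<beta>)\<close> and \<open>N = N(I)\<close>. Since \<open>I\<close> times its conjugate is \<open>N \<O>\<close>, one
  can write \<open>N = \<alpha> P' + \<beta> Q'\<close> with conjugates of elements \<open>P\<close>, \<open>Q\<close> of \<open>I\<close>, and solving for \<open>v\<close> in the
  basis \<open>u\<close>, \<open>(- Q', P') / N\<close> gives a solution with entries in \<open>I\<close>, so that \<open>I\<close> is the ideal of all
  four entries. The converse only uses that products \<open>x * cnj y\<close> of entries lie in \<open>N \<O>\<close>.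
\<close>

section \<open>Integers of an imaginary quadratic field\<close>

text \<open>In lowest terms \<open>q = a / b\<close> the assumption makes \<open>b ^ k\<close>
  divide \<open>M\<close> for every \<open>k\<close>. For \<open>b \<ge> 2\<close> this fails at
  \<open>k = \<bar>M\<bar>\<close>, because \<open>2 ^ k > k\<close>.\<close>

lemma Ints_if_bounded_powers:
  fixes q :: real and M :: int
  assumes "M \<noteq> 0" and pow: "\<And>k. of_int M * q ^ k \<in> \<int>"
  shows "q \<in> \<int>"
proof -
  obtain u where u: "of_int M * q = of_int u"
    using pow[of 1] by (auto elim: Ints_cases)
  then have "q = of_int u / of_int M"
    using assms(1) by (simp add: field_simps)
  then have "q \<in> \<rat>" by simp
  then obtain a b :: int where b: "b > 0" and cop: "coprime a b" and q: "q = of_int a / of_int b"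
    by (rule Rats_cases')
  have dvd: "b ^ k dvd M" for k
  proof -
    obtain m where "of_int M * q ^ k = of_int m"
      using pow[of k] by (auto elim: Ints_cases)
    then have "real_of_int (M * a ^ k) = of_int (m * b ^ k)"
      using b by (simp add: q power_divide field_simps)
    then have "M * a ^ k = m * b ^ k"
      by (simp only: of_int_eq_iff)
    then have "b ^ k dvd M * a ^ k"
      by simp
    moreover have "coprime (b ^ k) (a ^ k)"
      using cop by (simp add: coprime_commute)
    ultimately show ?thesis
      by (simp add: coprime_dvd_mult_left_iff)
  qed
  have "b = 1"
  proof (rule ccontr)
    assume "b \<noteq> 1"
    with b have "b \<ge> 2" by simp
    let ?k = "nat \<bar>M\<bar>"
    have "\<bar>M\<bar> < 2 ^ ?k"
      using of_nat_less_two_power[of ?k, where 'a = int] by simp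
    also have "(2::int) ^ ?k \<le> b ^ ?k"
      using \<open>b \<ge> 2\<close> by (intro power_mono) auto
    also have "b ^ ?k \<le> \<bar>M\<bar>"
      using dvd_imp_le_int[OF assms(1) dvd[of ?k]] b by simp
    finally show False by simp
  qed
  then show ?thesis using q by simp
qed

section \<open>The field as a vector space over the rationals\<close>

lemma
  assumes "subfield_of_complex K"
  shows subfield_0: "0 \<in> K" and subfield_1: "1 \<in> K"
    and subfield_diff: "x \<in> K \<Longrightarrow> y \<in> K \<Longrightarrow> x - y \<in> K"
    and subfield_add: "x \<in> K \<Longrightarrow> y \<in> K \<Longrightarrow> x + y \<in> K"
    and subfield_mult: "x \<in> K \<Longrightarrow> y \<in> K \<Longrightarrow> x * y \<in> K"
    and subfield_divide: "x \<in> K \<Longrightarrow> y \<in> K \<Longrightarrow> x / y \<in> K"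
    and subfield_of_int: "of_int m \<in> K"
    and subfield_of_rat: "of_rat r \<in> K"
proof -
  have diff: "x - y \<in> K" and mult: "x * y \<in> K" and inv: "inverse x \<in> K"
    if "x \<in> K" "y \<in> K" for x y
    using assms that by (auto simp: subfield_of_complex_def)
  show "0 \<in> K" "1 \<in> K"
    using assms by (auto simp: subfield_of_complex_def)
  note 0 = this(1) and 1 = this(2)
  have um: "- x \<in> K" if "x \<in> K" for x
    using diff[OF 0 that] by simp
  have add: "x + y \<in> K" if "x \<in> K" "y \<in> K" for x y
    using diff[OF that(1) um[OF that(2)]] by simp
  have div: "x / y \<in> K" if "x \<in> K" "y \<in> K" for x y
    using mult[OF that(1) inv[OF that(2) that(2)]] by (simp add: divide_inverse)
  have int: "of_int m \<in> K" for m
    by (induction m rule: int_induct[where k = 0]) (auto intro: 0 1 add diff)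
  have "of_rat r \<in> K" for r
    by (cases r) (auto simp: Fract_of_int_quotient of_rat_divide intro: div int)
  then show "x \<in> K \<Longrightarrow> y \<in> K \<Longrightarrow> x - y \<in> K" "x \<in> K \<Longrightarrow> y \<in> K \<Longrightarrow> x + y \<in> K"
    "x \<in> K \<Longrightarrow> y \<in> K \<Longrightarrow> x * y \<in> K"
    "x \<in> K \<Longrightarrow> y \<in> K \<Longrightarrow> x / y \<in> K" "of_int m \<in> K" "of_rat r \<in> K"
    using diff add mult div int by auto
qed

lemma of_real_of_rat_complex: "complex_of_real (of_rat q) = of_rat q"
  by (cases q) (auto simp: Fract_of_int_quotient of_rat_divide)

text \<open>Makes the linear algebra of the library available for the
  \<open>vector_space.dim\<close> in the definition of the field.\<close>

interpretation rat_complex: vector_space "\<lambda>(q::rat) (z::complex). of_rat q * z"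
  by unfold_locales (auto simp: algebra_simps of_rat_add of_rat_mult)

text \<open>A nonreal \<open>\<theta>\<close> is independent of 1 over the rationals. A basis of
  \<open>K\<close> that extends \<open>{\<theta>, 1}\<close> has only two elements, so the extension
  adds nothing.\<close>

lemma quadratic_field_span:
  assumes "imaginary_quadratic_field K" "\<theta> \<in> K" "\<theta> \<notin> \<real>" "x \<in> K"
  obtains p q where "x = of_rat p + of_rat q * \<theta>"
proof -
  have K: "subfield_of_complex K" and dim: "rat_complex.dim K = 2"
    using assms(1) by (auto simp: imaginary_quadratic_field_def)
  have "1 \<noteq> \<theta>" using assms(3) by auto
  have "\<theta> \<notin> rat_complex.span {1}"
    using assms(3) by (auto simp: rat_complex.span_singleton)
       (metis Reals_of_real of_real_of_rat_complex)
  then have ind: "rat_complex.independent {\<theta>, 1}"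
    by (intro rat_complex.independent_insertI) (auto simp: rat_complex.independent_empty)
  have "{\<theta>, 1} \<subseteq> K" using assms(2) subfield_1[OF K] by simp
  then obtain B where B: "{\<theta>, 1} \<subseteq> B" "B \<subseteq> K" "rat_complex.independent B" "K \<subseteq> rat_complex.span B"
    using rat_complex.maximal_independent_subset_extend[OF _ ind] by metis
  then have "card B = 2"
    using rat_complex.basis_card_eq_dim dim by simp
  moreover have "card {\<theta>, 1} = 2" using \<open>1 \<noteq> \<theta>\<close> by simp
  ultimately have "B = {\<theta>, 1}"
    using B(1) by (metis card_subset_eq card.infinite zero_neq_numeral)
  then have "x \<in> rat_complex.span {\<theta>, 1}" using B(4) assms(4) by auto
  then obtain k where "x - of_rat k * \<theta> \<in> rat_complex.span {1}"
    by (auto simp: rat_complex.span_breakdown_eq)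
  then obtain p where "x - of_rat k * \<theta> = of_rat p"
    by (auto simp: rat_complex.span_singleton)
  then show ?thesis using that[of p k] by (simp add: algebra_simps)
qed

text \<open>Completing the square in the quadratic equation of a nonreal element gives
  \<open>\<phi>\<close> with rational square. Being nonreal, \<open>\<phi>\<close> is purely
  imaginary and its square negative; multiplying by the denominator of the square makes the square
  an integer.\<close>

lemma quadratic_field_generator:
  assumes "imaginary_quadratic_field K"
  obtains \<eta> :: complex and d :: int
  where "d > 0" "\<eta>\<^sup>2 = - of_int d" "\<eta> \<in> K" "Re \<eta> = 0" "Im \<eta> \<noteq> 0"
    "\<And>x. x \<in> K \<Longrightarrow> \<exists>p q. x = of_rat p + of_rat q * \<eta>"
proof -
  have K: "subfield_of_complex K" and "\<not> K \<subseteq> \<real>"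
    using assms by (auto simp: imaginary_quadratic_field_def)
  then obtain \<theta> where \<theta>: "\<theta> \<in> K" "\<theta> \<notin> \<real>" by auto
  obtain p q where pq: "\<theta> * \<theta> = of_rat p + of_rat q * \<theta>"
    using quadratic_field_span[OF assms \<theta> subfield_mult[OF K \<theta>(1) \<theta>(1)]] .
  define \<phi> where "\<phi> = \<theta> - of_rat (q / 2)"
  define r where "r = p + q\<^sup>2 / 4"
  have sq: "\<phi>\<^sup>2 = of_rat r"
    unfolding \<phi>_def r_def power2_eq_square
    by (simp add: pq of_rat_add of_rat_divide of_rat_mult algebra_simps)
  have "\<phi> \<notin> \<real>"
    using \<theta>(2) unfolding \<phi>_def by (metis Reals_add Reals_of_real diff_add_cancel of_real_of_rat_complex)
  have Im: "Im \<phi> \<noteq> 0"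
    using \<open>\<phi> \<notin> \<real>\<close> complex_is_Real_iff by auto
  have sq': "\<phi>\<^sup>2 = of_real (of_rat r)" using sq by (simp add: of_real_of_rat_complex)
  have "Im (\<phi>\<^sup>2) = 0" unfolding sq' by simp
  then have Re: "Re \<phi> = 0" using Im by (simp add: power2_eq_square)
  have "Re (\<phi>\<^sup>2) = of_rat r" unfolding sq' by simp
  then have "of_rat r = - (Im \<phi>)\<^sup>2" using Re by (simp add: power2_eq_square)
  then have "(of_rat r :: real) < 0" using Im by simp
  then have "r < 0" by simp
  obtain a b where r: "r = Fract a b" "b > 0" by (cases r) auto
  then have "a < 0" using \<open>r < 0\<close> by (simp add: Fract_less_zero_iff)
  have r': "(of_rat r :: complex) = of_int a / of_int b"
    using r by (simp add: of_rat_rat)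
  define \<eta> where "\<eta> = of_int b * \<phi>"
  show thesis
  proof (rule that[of "- (a * b)" \<eta>])
    show "- (a * b) > 0" using r(2) \<open>a < 0\<close> by (simp add: mult_neg_pos)
    show "\<eta>\<^sup>2 = - of_int (- (a * b))"
      unfolding \<eta>_def power_mult_distrib sq r' using r(2) by (simp add: power2_eq_square)
    show "\<eta> \<in> K" unfolding \<eta>_def \<phi>_def
      by (intro subfield_mult subfield_diff subfield_of_int subfield_of_rat \<theta> K)
    show "Re \<eta> = 0" "Im \<eta> \<noteq> 0" using Re Im r(2) by (auto simp: \<eta>_def)
    then have "\<eta> \<notin> \<real>" using complex_is_Real_iff by auto
    show "\<exists>p q. x = of_rat p + of_rat q * \<eta>" if "x \<in> K" for x
      using quadratic_field_span[OF assms \<open>\<eta> \<in> K\<close> \<open>\<eta> \<notin> \<real>\<close> that] by metis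
  qed
qed

text \<open>
  The common denominator of the powers of \<open>x\<close> forces the norm of \<open>x\<close> to be an integer; the trace
  follows from the norm of \<open>x + 1\<close>.
\<close>
lemma bounded_denominator_powers:
  fixes x \<eta> :: complex
  assumes "algebraic_int x" and \<eta>: "\<eta>\<^sup>2 = - of_int d"
    and x: "x = of_rat p + of_rat q * \<eta>"
  obtains M :: int where "M \<noteq> 0" "\<And>k. \<exists>a b. of_int M * x ^ k = of_int a + of_int b * \<eta>"
proof -
  define L where "L = {of_int a + of_int b * \<eta> | a b. True}"
  have L_int: "of_int m \<in> L" for m
    unfolding L_def by (auto intro: exI[of _ m] exI[of _ 0])
  have L_add: "u + v \<in> L" if "u \<in> L" "v \<in> L" for u v
  proof -
    from that obtain a b a' b' where "u = of_int a + of_int b * \<eta>" "v = of_int a' + of_int b' * \<eta>"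
      unfolding L_def by auto
    then have "u + v = of_int (a + a') + of_int (b + b') * \<eta>"
      by (simp add: algebra_simps)
    then show ?thesis unfolding L_def by blast
  qed
  have L_mult: "u * v \<in> L" if "u \<in> L" "v \<in> L" for u v
  proof -
    from that obtain a b a' b' where "u = of_int a + of_int b * \<eta>" "v = of_int a' + of_int b' * \<eta>"
      unfolding L_def by auto
    then have "u * v = of_int (a * a') + of_int (a * b' + b * a') * \<eta> + of_int (b * b') * \<eta>\<^sup>2"
      by (simp add: algebra_simps power2_eq_square)
    also have "\<dots> = of_int (a * a' - b * b' * d) + of_int (a * b' + b * a') * \<eta>"
      unfolding \<eta> by (simp add: algebra_simps)
    finally show ?thesis unfolding L_def by blast
  qed
  have L_power: "u ^ k \<in> L" if "u \<in> L" for u k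
    by (induction k) (use L_int[of 1] L_mult that in auto)
  have L_sum: "(\<Sum>i\<in>A. h i) \<in> L" if "\<And>i. i \<in> A \<Longrightarrow> h i \<in> L" for h :: "nat \<Rightarrow> complex" and A
    using that by (induction A rule: infinite_finite_induct) (use L_int[of 0] L_add in auto)
  obtain p1 p2 where p: "p = Fract p1 p2" "p2 > 0" by (cases p) auto
  obtain q1 q2 where q: "q = Fract q1 q2" "q2 > 0" by (cases q) auto
  define m where "m = p2 * q2"
  have "m \<noteq> 0" using p q by (simp add: m_def)
  have mx: "of_int m * x \<in> L"
  proof -
    have "of_int m * x = of_int (p1 * q2) + of_int (q1 * p2) * \<eta>"
      using p q by (simp add: m_def x of_rat_rat field_simps)
    then show ?thesis unfolding L_def by blast
  qed
  from assms(1) obtain f where f: "lead_coeff f = 1" "\<forall>i. coeff f i \<in> \<int>" "poly f x = 0"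
    by (auto simp: algebraic_int.simps)
  define n where "n = degree f"
  have "(\<Sum>i\<le>n. coeff f i * x ^ i) = 0"
    using f(3) by (simp add: poly_altdef n_def)
  then have "(\<Sum>i<n. coeff f i * x ^ i) + x ^ n = 0"
    using f(1) by (simp add: lessThan_Suc_atMost[symmetric] n_def)
  then have xn: "x ^ n = (\<Sum>i<n. - coeff f i * x ^ i)"
    by (simp add: sum_negf add_eq_0_iff add.commute)
  \<comment> \<open>The single denominator \<open>m ^ n\<close> suffices for all powers: below the
    degree \<open>n\<close> it is a multiple of the denominator \<open>m ^ k\<close>, and from
    \<open>n\<close> on the monic equation reduces \<open>x ^ k\<close> to smaller powers.\<close>
  have "of_int (m ^ n) * x ^ k \<in> L" for k
  proof (induction k rule: less_induct)
    case (less k)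
    show ?case
    proof (cases "k < n")
      case True
      then have "of_int (m ^ n) * x ^ k = of_int (m ^ (n - k)) * (of_int m * x) ^ k"
        by (simp add: power_mult_distrib flip: power_add mult.assoc)
      then show ?thesis using L_mult L_int L_power mx by metis
    next
      case False
      then have "x ^ k = x ^ (k - n) * x ^ n" by (simp flip: power_add)
      also have "of_int (m ^ n) * \<dots> = (\<Sum>i<n. - coeff f i * (of_int (m ^ n) * x ^ (k - n + i)))"
        unfolding xn by (simp add: sum_distrib_left power_add mult_ac)
      also have "\<dots> \<in> L"
      proof (rule L_sum)
        fix i assume "i \<in> {..<n}"
        with False have "k - n + i < k" by auto
        moreover have "- coeff f i \<in> L"
          using f(2) L_int by (metis Ints_cases Ints_minus)
        ultimately show "- coeff f i * (of_int (m ^ n) * x ^ (k - n + i)) \<in> L"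
          using less L_mult by blast
      qed
      finally show ?thesis .
    qed
  qed
  then show thesis
    using that[of "m ^ n"] \<open>m \<noteq> 0\<close> unfolding L_def by auto
qed

text \<open>The norm is multiplicative, so \<open>M\<^sup>2\<close> times a power of the norm of
  \<open>x\<close> is the norm of some \<open>a + b * \<eta>\<close>, which is the integer
  \<open>a\<^sup>2 + b\<^sup>2 * d\<close>. Hence the powers of the norm of \<open>x\<close> have a
  bounded denominator.\<close>

lemma integer_norm:
  fixes x \<eta> :: complex
  assumes \<eta>: "\<eta>\<^sup>2 = - of_int d" "Re \<eta> = 0" and "M \<noteq> 0"
    and pow: "\<And>k. \<exists>a b. of_int M * x ^ k = of_int a + of_int b * \<eta>"
  shows "(cmod x)\<^sup>2 \<in> \<int>"
proof (rule Ints_if_bounded_powers)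
  show "M\<^sup>2 \<noteq> 0" using assms by simp
  have "Re (\<eta>\<^sup>2) = - of_int d" unfolding \<eta> by simp
  then have Im: "(Im \<eta>)\<^sup>2 = of_int d" using \<eta>(2) by (simp add: power2_eq_square)
  fix k
  obtain a b where ab: "of_int M * x ^ k = of_int a + of_int b * \<eta>"
    using pow by blast
  have "of_int (M\<^sup>2) * ((cmod x)\<^sup>2) ^ k = (cmod (of_int M * x ^ k))\<^sup>2"
    by (simp add: norm_mult norm_power power_mult_distrib flip: power_mult)
       (simp add: mult.commute)
  also have "\<dots> = (of_int a)\<^sup>2 + (of_int b)\<^sup>2 * (Im \<eta>)\<^sup>2"
    unfolding ab cmod_power2 using \<eta>(2) by (simp add: power_mult_distrib)
  also have "\<dots> \<in> \<int>" unfolding Im by auto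
  finally show "of_int (M\<^sup>2) * ((cmod x)\<^sup>2) ^ k \<in> \<int>" .
qed

text \<open>Integrality becomes a condition on trace and norm, which serves as the working
  description of the ring. For the backward direction, \<open>x\<close> is a root of the monic
  polynomial with the trace and norm as coefficients.\<close>

lemma ring_of_integers_iff:
  assumes "imaginary_quadratic_field K"
  shows "x \<in> ring_of_integers K \<longleftrightarrow> x \<in> K \<and> 2 * Re x \<in> \<int> \<and> (cmod x)\<^sup>2 \<in> \<int>"
proof
  assume "x \<in> ring_of_integers K"
  then have x: "x \<in> K" "algebraic_int x" by (auto simp: ring_of_integers_def)
  obtain \<eta> d where \<eta>: "\<eta>\<^sup>2 = - of_int d" "Re \<eta> = 0"
    and span: "\<And>x. x \<in> K \<Longrightarrow> \<exists>p q. x = of_rat p + of_rat q * \<eta>"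
    using quadratic_field_generator[OF assms] by metis
  obtain M where M: "M \<noteq> 0" "\<And>k. \<exists>a b. of_int M * x ^ k = of_int a + of_int b * \<eta>"
    using bounded_denominator_powers[OF x(2) \<eta>(1)] span[OF x(1)] by metis
  then obtain a b where ab: "\<And>k. of_int M * x ^ k = of_int (a k) + of_int (b k) * \<eta>"
    by metis
  have norm: "(cmod x)\<^sup>2 \<in> \<int>"
    using integer_norm[OF \<eta> M] .
  \<comment> \<open>By the binomial theorem the same \<open>M\<close> clears the denominators of the
    powers of \<open>x + 1\<close>.\<close>
  have "\<exists>a b. of_int M * (x + 1) ^ k = of_int a + of_int b * \<eta>" for k
  proof -
    have "of_int M * (x + 1) ^ k = (\<Sum>i\<le>k. of_nat (k choose i) * (of_int M * x ^ i))"
      by (simp add: binomial_ring sum_distrib_left mult_ac)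
    also have "\<dots> = of_int (\<Sum>i\<le>k. int (k choose i) * a i) + of_int (\<Sum>i\<le>k. int (k choose i) * b i) * \<eta>"
      unfolding ab by (simp add: algebra_simps sum.distrib sum_distrib_left)
    finally show ?thesis by blast
  qed
  from integer_norm[OF \<eta> M(1) this] have "(cmod (x + 1))\<^sup>2 \<in> \<int>" .
  moreover have "2 * Re x = (cmod (x + 1))\<^sup>2 - (cmod x)\<^sup>2 - 1"
    unfolding cmod_power2 by (simp add: power2_eq_square algebra_simps)
  ultimately have "2 * Re x \<in> \<int>" using norm by auto
  then show "x \<in> K \<and> 2 * Re x \<in> \<int> \<and> (cmod x)\<^sup>2 \<in> \<int>" using x norm by simp
next
  assume x: "x \<in> K \<and> 2 * Re x \<in> \<int> \<and> (cmod x)\<^sup>2 \<in> \<int>"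
  then obtain t n where t: "2 * Re x = of_int t" and n: "(cmod x)\<^sup>2 = of_int n"
    by (auto elim!: Ints_cases)
  have "x\<^sup>2 - of_int t * x + of_int n = 0"
  proof -
    have "of_int t = x + cnj x" "of_int n = x * cnj x"
      using t n complex_add_cnj[of x] complex_norm_square[of x] by auto
    then show ?thesis by (simp add: power2_eq_square algebra_simps)
  qed
  then have "poly [:of_int n, - of_int t, 1:] x = 0"
    by (simp add: algebra_simps power2_eq_square)
  moreover have "\<forall>i. coeff [:of_int n, - of_int t, 1 :: complex:] i \<in> \<int>"
    by (auto simp: coeff_pCons split: nat.split)
  ultimately have "algebraic_int x" by (intro algebraic_int.intros) auto
  then show "x \<in> ring_of_integers K" using x by (simp add: ring_of_integers_def)
qed

section \<open>Ring structure of the integers\<close>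

locale imaginary_quadratic =
  fixes K :: "complex set"
  assumes field: "imaginary_quadratic_field K"
begin

abbreviation \<O> :: "complex set" where "\<O> \<equiv> ring_of_integers K"

lemma subfield: "subfield_of_complex K"
  using field by (simp add: imaginary_quadratic_field_def)

lemma Re_rational: "x \<in> K \<Longrightarrow> Re x \<in> \<rat>"
  and cnj_field: "x \<in> K \<Longrightarrow> cnj x \<in> K"
proof -
  assume "x \<in> K"
  obtain \<eta> where "Re \<eta> = 0" and "\<And>x. x \<in> K \<Longrightarrow> \<exists>p q. x = of_rat p + of_rat q * \<eta>"
    using quadratic_field_generator[OF field] by metis
  with \<open>x \<in> K\<close> obtain p q where x: "x = of_rat p + of_rat q * \<eta>" and "Re \<eta> = 0"
    by blast
  then have Re: "Re x = of_rat p"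
    by (simp flip: of_real_of_rat_complex)
  then show "Re x \<in> \<rat>" by simp
  have "cnj x = 2 * of_rat p - x"
    using Re by (simp add: complex_eq_iff flip: of_real_of_rat_complex)
  also have "\<dots> = of_rat (2 * p) - x"
    by (simp add: of_rat_mult)
  finally show "cnj x \<in> K"
    using subfield_diff[OF subfield subfield_of_rat[OF subfield] \<open>x \<in> K\<close>] by simp
qed

lemma integer_iff: "x \<in> \<O> \<longleftrightarrow> x \<in> K \<and> 2 * Re x \<in> \<int> \<and> (cmod x)\<^sup>2 \<in> \<int>"
  by (rule ring_of_integers_iff[OF field])

lemma integer_field: "x \<in> \<O> \<Longrightarrow> x \<in> K"
  by (simp add: integer_iff)

lemma integer_of_int [simp]: "of_int m \<in> \<O>"
  using subfield_of_int[OF subfield] by (simp add: ring_of_integers_def)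

lemma integer_0 [simp]: "0 \<in> \<O>" and integer_1 [simp]: "1 \<in> \<O>"
  using integer_of_int[of 0] integer_of_int[of 1] by simp_all

lemma integer_cnj: "x \<in> \<O> \<Longrightarrow> cnj x \<in> \<O>"
  by (auto simp: integer_iff cnj_field)

text \<open>
  The traces of \<open>x * cnj y\<close> and \<open>x * y\<close> are rational numbers with integral sum and product.
\<close>
lemma mixed_trace_integral:
  assumes "x \<in> \<O>" "y \<in> \<O>"
  shows "2 * Re (x * cnj y) \<in> \<int>" and "2 * Re (x * y) \<in> \<int>"
proof -
  obtain tx ty nx ny where
    t: "2 * Re x = of_int tx" "2 * Re y = of_int ty" and
    n: "(cmod x)\<^sup>2 = of_int nx" "(cmod y)\<^sup>2 = of_int ny"
    using assms unfolding integer_iff by (meson Ints_cases)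
  define s where "s = 2 * Re (x * cnj y)"
  \<comment> \<open>The product of the traces of \<open>x * cnj y\<close> and \<open>x * y\<close>,
    with the imaginary parts eliminated in favour of the norms.\<close>
  define q where "q = nx * ty\<^sup>2 + ny * tx\<^sup>2 - 4 * nx * ny"
  have re: "Re x = of_int tx / 2" "Re y = of_int ty / 2"
    using t by simp_all
  have im: "(Im x)\<^sup>2 = of_int nx - (of_int tx / 2)\<^sup>2" "(Im y)\<^sup>2 = of_int ny - (of_int ty / 2)\<^sup>2"
    using n re by (simp_all add: cmod_power2)
  have sum: "2 * Re (x * y) = of_int (tx * ty) - s"
    unfolding s_def by (simp add: re algebra_simps)
  have "s * (2 * Re (x * y)) = 4 * ((Re x)\<^sup>2 * (Re y)\<^sup>2 - (Im x)\<^sup>2 * (Im y)\<^sup>2)"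
    unfolding s_def by (simp add: power2_eq_square algebra_simps)
  also have "\<dots> = of_int q"
    unfolding re im q_def by (simp add: power2_eq_square algebra_simps)
  finally have root: "s\<^sup>2 - of_int (tx * ty) * s + of_int q = 0"
    unfolding sum by (simp add: power2_eq_square algebra_simps)
  then have "poly [:of_int q, - of_int (tx * ty), 1:] s = 0"
    by (simp add: algebra_simps power2_eq_square)
  moreover have "\<forall>i. coeff [:of_int q, - of_int (tx * ty), 1 :: real:] i \<in> \<int>"
    by (auto simp: coeff_pCons simp del: of_int_mult split: nat.split)
  ultimately have "algebraic_int s" by (intro algebraic_int.intros) auto
  moreover have "s \<in> \<rat>"
  proof -
    have "x * cnj y \<in> K"
      using assms by (intro subfield_mult[OF subfield] cnj_field integer_field)
    then show ?thesis
      unfolding s_def by (intro Rats_mult Rats_number_of Re_rational)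
  qed
  ultimately have "s \<in> \<int>" by (rule rational_algebraic_int_is_int)
  then show "2 * Re (x * y) \<in> \<int>"
    unfolding sum by (intro Ints_diff Ints_of_int)
  show "2 * Re (x * cnj y) \<in> \<int>"
    using \<open>s \<in> \<int>\<close> unfolding s_def .
qed

lemma integer_mult: "x \<in> \<O> \<Longrightarrow> y \<in> \<O> \<Longrightarrow> x * y \<in> \<O>"
  using mixed_trace_integral(2)[of x y]
  by (auto simp: integer_iff norm_mult power_mult_distrib intro: subfield_mult[OF subfield])

lemma integer_diff:
  assumes "x \<in> \<O>" "y \<in> \<O>"
  shows "x - y \<in> \<O>"
proof -
  have "(cmod (x - y))\<^sup>2 = (cmod x)\<^sup>2 + (cmod y)\<^sup>2 - 2 * Re (x * cnj y)"
    unfolding cmod_power2 by (simp add: power2_eq_square algebra_simps)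
  then have "(cmod (x - y))\<^sup>2 \<in> \<int>"
    using assms mixed_trace_integral(1)[OF assms] by (auto simp: integer_iff)
  moreover have "2 * Re (x - y) = 2 * Re x - 2 * Re y" by simp
  ultimately show ?thesis
    using assms by (auto simp: integer_iff intro: subfield_diff[OF subfield] simp del: minus_complex.simps)
qed

lemma integer_uminus: "x \<in> \<O> \<Longrightarrow> - x \<in> \<O>"
  using integer_diff[of 0 x] by simp

lemma integer_add: "x \<in> \<O> \<Longrightarrow> y \<in> \<O> \<Longrightarrow> x + y \<in> \<O>"
  using integer_diff[of x "- y"] integer_uminus by simp

lemma real_integer:
  assumes "x \<in> \<O>" "Im x = 0"
  obtains m where "x = of_int m"
proof -
  have x: "x = of_real (Re x)" using assms(2) by (simp add: complex_eq_iff)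
  then have "algebraic_int (Re x)"
    using assms(1) by (metis ring_of_integers_def mem_Collect_eq algebraic_int_of_real_iff)
  then have "Re x \<in> \<int>"
    using rational_algebraic_int_is_int Re_rational integer_field assms(1) by blast
  then show thesis using that x by (metis Ints_cases of_real_of_int_eq)
qed

text \<open>The generator \<open>\<eta>\<close> is integral, so it is enough to clear the
  denominators of the two rational coordinates.\<close>

lemma denominator:
  assumes "x \<in> K"
  obtains m :: int where "m > 0" "of_int m * x \<in> \<O>"
proof -
  obtain \<eta> d where \<eta>: "\<eta>\<^sup>2 = - of_int d" "\<eta> \<in> K"
    and span: "\<And>x. x \<in> K \<Longrightarrow> \<exists>p q. x = of_rat p + of_rat q * \<eta>"
    using quadratic_field_generator[OF field] by metis
  have "algebraic_int \<eta>"
    by (rule algebraic_int_root[of "- of_int d" "monom 1 2"]) (auto simp: \<eta> poly_monom degree_monom_eq)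
  then have "\<eta> \<in> \<O>" using \<eta> by (simp add: ring_of_integers_def)
  obtain p q where x: "x = of_rat p + of_rat q * \<eta>" using span assms by blast
  obtain p1 p2 where p: "p = Fract p1 p2" "p2 > 0" by (cases p) auto
  obtain q1 q2 where q: "q = Fract q1 q2" "q2 > 0" by (cases q) auto
  have "of_int (p2 * q2) * x = of_int (p1 * q2) + of_int (q1 * p2) * \<eta>"
    using p q by (simp add: x of_rat_rat field_simps)
  also have "\<dots> \<in> \<O>"
    using \<open>\<eta> \<in> \<O>\<close> by (intro integer_add integer_mult integer_of_int)
  finally show thesis using that[of "p2 * q2"] p q by simp
qed

section \<open>Integral basis and discriminant\<close>

text \<open>An integer of least positive imaginary part. Together with 1 it will form an integral
  basis.\<close>

definition \<omega> :: complex where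
  "\<omega> = (SOME w. w \<in> \<O> \<and> Im w > 0 \<and> (\<forall>x\<in>\<O>. Im x > 0 \<longrightarrow> Im w \<le> Im x))"

lemma
  shows \<omega>_integer [simp]: "\<omega> \<in> \<O>" and Im_\<omega>_pos: "Im \<omega> > 0"
    and Im_\<omega>_le: "x \<in> \<O> \<Longrightarrow> Im x > 0 \<Longrightarrow> Im \<omega> \<le> Im x"
proof -
  have "\<exists>w. w \<in> \<O> \<and> Im w > 0"
  proof -
    obtain z where z: "z \<in> K" "z \<notin> \<real>"
      using field by (auto simp: imaginary_quadratic_field_def)
    obtain m where m: "m > 0" "of_int m * z \<in> \<O>" using denominator[OF z(1)] .
    have "Im (of_int m * z) \<noteq> 0" using m z(2) by (simp add: complex_is_Real_iff)
    then have "Im (of_int m * z) > 0 \<or> Im (- (of_int m * z)) > 0"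
      by (metis uminus_complex.simps(2) linorder_neqE_linordered_idom neg_0_less_iff_less)
    then show ?thesis using m(2) integer_uminus by blast
  qed
  then obtain w where w: "w \<in> \<O> \<and> Im w > 0" ..
  \<comment> \<open>The minimum exists because \<open>4 * (Im x)\<^sup>2\<close> is four times the
    norm minus the squared trace, hence a natural number for integers \<open>x\<close>.\<close>
  define \<mu> where "\<mu> x = nat \<lfloor>4 * (Im x)\<^sup>2\<rfloor>" for x
  have \<mu>: "real (\<mu> x) = 4 * (Im x)\<^sup>2" if "x \<in> \<O>" for x
  proof -
    have int: "2 * Re x \<in> \<int>" "(cmod x)\<^sup>2 \<in> \<int>" using that by (simp_all add: integer_iff)
    have "4 * (Im x)\<^sup>2 = 4 * (cmod x)\<^sup>2 - (2 * Re x)\<^sup>2"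
      unfolding cmod_power2 by (simp add: power2_eq_square algebra_simps)
    also have "\<dots> \<in> \<int>"
      by (rule Ints_diff[OF Ints_mult[OF Ints_numeral int(2)] Ints_power[OF int(1)]])
    finally show ?thesis unfolding \<mu>_def by (auto elim!: Ints_cases)
  qed
  obtain w' where w': "w' \<in> \<O>" "Im w' > 0" "\<And>x. x \<in> \<O> \<and> Im x > 0 \<Longrightarrow> \<mu> w' \<le> \<mu> x"
    using ex_has_least_nat[of "\<lambda>w. w \<in> \<O> \<and> Im w > 0" w \<mu>, OF w] by blast
  have "Im w' \<le> Im x" if "x \<in> \<O>" "Im x > 0" for x
  proof -
    have "real (\<mu> w') \<le> real (\<mu> x)" using w'(3) that by simp
    then have "(Im w')\<^sup>2 \<le> (Im x)\<^sup>2" using \<mu> w'(1) that by simp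
    from power2_le_imp_le[OF this] show ?thesis using that(2) by simp
  qed
  then have "\<exists>w. w \<in> \<O> \<and> Im w > 0 \<and> (\<forall>x\<in>\<O>. Im x > 0 \<longrightarrow> Im w \<le> Im x)"
    using w' by blast
  from someI_ex[OF this] show "\<omega> \<in> \<O>" "Im \<omega> > 0"
    and "x \<in> \<O> \<Longrightarrow> Im x > 0 \<Longrightarrow> Im \<omega> \<le> Im x"
    unfolding \<omega>_def by blast+
qed

text \<open>Division with remainder of imaginary parts by \<open>Im \<omega>\<close>: by minimality
  the remainder is real, hence a rational integer.\<close>

lemma integer_expand:
  assumes "x \<in> \<O>"
  obtains m n where "x = of_int m + of_int n * \<omega>"
proof -
  define n where "n = \<lfloor>Im x / Im \<omega>\<rfloor>"
  define y where "y = x - of_int n * \<omega>"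
  have y: "y \<in> \<O>"
    unfolding y_def by (intro integer_diff integer_mult assms integer_of_int \<omega>_integer)
  have "of_int n \<le> Im x / Im \<omega>" "Im x / Im \<omega> < of_int n + 1"
    unfolding n_def by linarith+
  then have "0 \<le> Im y" "Im y < Im \<omega>"
    using Im_\<omega>_pos by (simp_all add: y_def field_simps)
  then have "Im y = 0" using Im_\<omega>_le[OF y] by force
  then obtain m where "y = of_int m" using real_integer[OF y] by blast
  then have "x = of_int m + of_int n * \<omega>" by (simp add: y_def algebra_simps)
  then show thesis by (rule that)
qed

lemma expansion_unique:
  assumes "of_int m + of_int n * \<omega> = of_int m' + of_int n' * \<omega>"
  shows "m = m'" "n = n'"
proof -
  have "of_int n * Im \<omega> = of_int n' * Im \<omega>"
    using arg_cong[OF assms, of Im] by simp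
  then show "n = n'" using Im_\<omega>_pos by simp
  then show "m = m'" using assms by simp
qed

lemma integral_basis: "integral_basis K 1 \<omega>"
  unfolding integral_basis_def
proof
  have "of_int m * 1 + of_int n * \<omega> \<in> \<O>" for m n
    by (intro integer_add integer_mult) simp_all
  moreover have "\<exists>m n. x = of_int m * 1 + of_int n * \<omega>" if "x \<in> \<O>" for x
    using integer_expand[OF that] by (metis mult.right_neutral)
  ultimately show "\<O> = {of_int m * 1 + of_int n * \<omega> | m n. True}"
    by blast
  show "\<forall>m n. of_int m * 1 + of_int n * \<omega> = 0 \<longrightarrow> m = 0 \<and> n = 0"
    using expansion_unique[of _ _ 0 0] by auto
qed

text \<open>Two integral bases express each other with integer coefficients, so their determinants
  differ by a sign and have the same square. The definite description is therefore determined by the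
  basis 1, \<open>\<omega>\<close>.\<close>

lemma field_discriminant: "of_int (field_discriminant K) = - (2 * Im \<omega>)\<^sup>2"
proof -
  define \<Delta> where "\<Delta> w1 w2 = w1 * cnj w2 - w2 * cnj w1" for w1 w2
  have change: "\<exists>k::int. \<Delta> v1 v2 = of_int k * \<Delta> w1 w2"
    if "integral_basis K w1 w2" "v1 \<in> \<O>" "v2 \<in> \<O>" for w1 w2 v1 v2
  proof -
    have \<O>: "\<O> = {of_int m * w1 + of_int n * w2 | m n. True}"
      using that(1) by (simp add: integral_basis_def)
    from that(2) obtain a b where 1: "v1 = of_int a * w1 + of_int b * w2"
      unfolding \<O> by auto
    from that(3) obtain c d where 2: "v2 = of_int c * w1 + of_int d * w2"
      unfolding \<O> by auto
    note 1 2
    then have "\<Delta> v1 v2 = of_int (a * d - b * c) * \<Delta> w1 w2"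
      by (simp add: \<Delta>_def algebra_simps)
    then show ?thesis by blast
  qed
  have basis_mem: "w1 \<in> \<O> \<and> w2 \<in> \<O>" if "integral_basis K w1 w2" for w1 w2
  proof -
    have "\<O> = {of_int m * w1 + of_int n * w2 | m n. True}"
      using that by (simp add: integral_basis_def)
    moreover have "w1 = of_int 1 * w1 + of_int 0 * w2" "w2 = of_int 0 * w1 + of_int 1 * w2"
      by simp_all
    ultimately show ?thesis by blast
  qed
  have \<Delta>\<omega>: "\<Delta> 1 \<omega> = - (2 * \<i> * of_real (Im \<omega>))"
    by (simp add: \<Delta>_def complex_eq_iff)
  then have sq: "(\<Delta> 1 \<omega>)\<^sup>2 = of_real (- (2 * Im \<omega>)\<^sup>2)"
    by (simp add: power2_eq_square)
  have unique: "(\<Delta> w1 w2)\<^sup>2 = (\<Delta> 1 \<omega>)\<^sup>2" if w: "integral_basis K w1 w2" for w1 w2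
  proof -
    obtain k where k: "\<Delta> 1 \<omega> = of_int k * \<Delta> w1 w2"
      using change[OF w] by (metis integer_1 \<omega>_integer)
    obtain k' where k': "\<Delta> w1 w2 = of_int k' * \<Delta> 1 \<omega>"
      using change[OF integral_basis] basis_mem[OF w] by metis
    have "\<Delta> 1 \<omega> = of_int (k * k') * \<Delta> 1 \<omega>"
      using k k' by simp
    moreover have "\<Delta> 1 \<omega> \<noteq> 0" unfolding \<Delta>\<omega> using Im_\<omega>_pos by simp
    ultimately have "complex_of_int (k * k') = of_int 1" by simp
    then have "k * k' = 1" by (simp only: of_int_eq_iff)
    then have "k'\<^sup>2 = 1" by (auto simp: zmult_eq_1_iff)
    then have "(of_int k' :: complex)\<^sup>2 = 1" by (simp flip: of_int_power)
    then show ?thesis by (simp add: k' power_mult_distrib)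
  qed
  obtain t n where t: "2 * Re \<omega> = of_int t" and n: "(cmod \<omega>)\<^sup>2 = of_int n"
    using \<omega>_integer unfolding integer_iff by (meson Ints_cases)
  have d: "- (2 * Im \<omega>)\<^sup>2 = of_int (t\<^sup>2 - 4 * n)"
  proof -
    have "- (2 * Im \<omega>)\<^sup>2 = (2 * Re \<omega>)\<^sup>2 - 4 * (cmod \<omega>)\<^sup>2"
      unfolding cmod_power2 by (simp add: power2_eq_square algebra_simps)
    then show ?thesis unfolding t n by simp
  qed
  have "field_discriminant K = t\<^sup>2 - 4 * n"
    unfolding field_discriminant_def
  proof (rule the_equality)
    show "\<exists>w1 w2. integral_basis K w1 w2 \<and> of_int (t\<^sup>2 - 4 * n) = (w1 * cnj w2 - w2 * cnj w1)\<^sup>2"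
    proof (intro exI conjI)
      show "integral_basis K 1 \<omega>" by (rule integral_basis)
      show "of_int (t\<^sup>2 - 4 * n) = (1 * cnj \<omega> - \<omega> * cnj 1)\<^sup>2"
        using sq unfolding d \<Delta>_def by (simp only: of_real_of_int_eq)
    qed
  next
    fix d' :: int
    assume "\<exists>w1 w2. integral_basis K w1 w2 \<and> of_int d' = (w1 * cnj w2 - w2 * cnj w1)\<^sup>2"
    then have "of_int d' = (\<Delta> 1 \<omega>)\<^sup>2" using unique unfolding \<Delta>_def by metis
    then have "complex_of_int d' = of_int (t\<^sup>2 - 4 * n)"
      unfolding sq d by (simp only: of_real_of_int_eq)
    then show "d' = t\<^sup>2 - 4 * n" by (simp only: of_int_eq_iff)
  qed
  then show ?thesis unfolding d by simp
qed

lemma sqrt_discriminant: "sqrt_discriminant K = \<omega> - cnj \<omega>"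
proof -
  have "\<bar>real_of_int (field_discriminant K)\<bar> = (2 * Im \<omega>)\<^sup>2"
    by (simp add: field_discriminant)
  then have "sqrt \<bar>of_int (field_discriminant K)\<bar> = 2 * Im \<omega>"
    using Im_\<omega>_pos by (simp only: real_sqrt_abs)
  then show ?thesis by (simp add: sqrt_discriminant_def complex_eq_iff)
qed

text \<open>The source of the lattice \<open>sqrt \<Delta> * \<int>\<close> for curvatures and
  cocurvatures: both arise as an integer minus its conjugate.\<close>

lemma diff_cnj:
  assumes "x \<in> \<O>"
  obtains n :: int where "x - cnj x = sqrt_discriminant K * of_int n"
proof -
  obtain m n where "x = of_int m + of_int n * \<omega>" using integer_expand[OF assms] .
  then have "x - cnj x = sqrt_discriminant K * of_int n"
    by (simp add: sqrt_discriminant algebra_simps)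
  then show thesis by (rule that)
qed

section \<open>Norms of ideals\<close>

text \<open>
  The ideal generated by the products \<open>x * cnj y\<close> for \<open>x\<close>, \<open>y\<close> in \<open>I\<close> is the one generated by \<open>N\<close>.
\<close>
definition has_norm :: "complex set \<Rightarrow> real \<Rightarrow> bool" where
  "has_norm I N \<longleftrightarrow> N > 0 \<and> (\<forall>x\<in>I. \<forall>y\<in>I. x * cnj y / of_real N \<in> \<O>) \<and>
     (\<exists>w1\<in>I. \<exists>s1\<in>I. \<exists>w2\<in>I. \<exists>s2\<in>I. of_real N = w1 * cnj s1 + w2 * cnj s2)"

text \<open>The quotient \<open>N / N'\<close> is a sum of products divided by \<open>N'\<close>, so
  it lies in \<open>\<O>\<close>, and it is real.\<close>

lemma has_norm_quotient:
  assumes "has_norm I N" "has_norm I N'"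
  obtains k :: int where "N = N' * of_int k"
proof -
  obtain w1 s1 w2 s2 where ws: "w1 \<in> I" "s1 \<in> I" "w2 \<in> I" "s2 \<in> I"
    and N: "of_real N = w1 * cnj s1 + w2 * cnj s2"
    using assms(1) unfolding has_norm_def by blast
  have N': "N' > 0" "\<And>x y. x \<in> I \<Longrightarrow> y \<in> I \<Longrightarrow> x * cnj y / of_real N' \<in> \<O>"
    using assms(2) unfolding has_norm_def by blast+
  have "of_real (N / N') = w1 * cnj s1 / of_real N' + w2 * cnj s2 / of_real N'"
    using N by (simp add: add_divide_distrib)
  also have "\<dots> \<in> \<O>" using ws by (intro integer_add N')
  finally have "of_real (N / N') \<in> \<O>" .
  then obtain k where "complex_of_real (N / N') = of_int k" by (rule real_integer) simp
  then have "N / N' = of_int k" by (metis of_real_eq_iff of_real_of_int_eq)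
  then have "N = N' * of_int k" using N'(1) by (simp add: field_simps)
  then show thesis by (rule that)
qed

lemma has_norm_unique:
  assumes "has_norm I N" "has_norm I N'"
  shows "N = N'"
proof -
  have pos: "N > 0" "N' > 0" using assms by (auto simp: has_norm_def)
  obtain k where k: "N = N' * of_int k" using has_norm_quotient[OF assms] .
  obtain k' where k': "N' = N * of_int k'" using has_norm_quotient[OF assms(2,1)] .
  have "real_of_int (k * k') = of_int 1" using k k' pos by (simp add: field_simps)
  then have "k * k' = 1" by (simp only: of_int_eq_iff)
  moreover have "k > 0" using k pos by (simp add: zero_less_mult_iff)
  ultimately have "k = 1" by (simp add: zmult_eq_1_iff)
  then show ?thesis using k by simp
qed

text \<open>Replacing \<open>I\<close> by \<open>d I\<close> multiplies every product
  \<open>x * cnj y\<close> by \<open>d * cnj d\<close>. This matches the denominator in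
  \<open>ideal_norm\<close>.\<close>

lemma has_norm_scale:
  assumes "has_norm ((*) d ` I) N" "d \<noteq> 0"
  shows "has_norm I (N / (cmod d)\<^sup>2)"
proof -
  have d: "complex_of_real ((cmod d)\<^sup>2) = d * cnj d" by (rule complex_norm_square)
  have N: "N > 0" "\<And>x y. x \<in> I \<Longrightarrow> y \<in> I \<Longrightarrow> (d * x) * cnj (d * y) / of_real N \<in> \<O>"
    using assms(1) unfolding has_norm_def by blast+
  obtain w1 s1 w2 s2 where ws: "w1 \<in> I" "s1 \<in> I" "w2 \<in> I" "s2 \<in> I"
    and eq: "of_real N = (d * w1) * cnj (d * s1) + (d * w2) * cnj (d * s2)"
    using assms(1) unfolding has_norm_def by blast
  have eq2: "x * cnj y / of_real (N / (cmod d)\<^sup>2) = (d * x) * cnj (d * y) / of_real N" for x y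
    unfolding of_real_divide d by (simp add: field_simps)
  have "\<forall>x\<in>I. \<forall>y\<in>I. x * cnj y / of_real (N / (cmod d)\<^sup>2) \<in> \<O>"
    unfolding eq2 using N(2) by blast
  moreover have "of_real (N / (cmod d)\<^sup>2) = w1 * cnj s1 + w2 * cnj s2"
    unfolding of_real_divide d eq using assms(2) by (simp add: field_simps)
  moreover have "N / (cmod d)\<^sup>2 > 0" using N(1) assms(2) by simp
  ultimately show ?thesis using ws unfolding has_norm_def by blast
qed

section \<open>Lattice basis and norm of an integral ideal\<close>

text \<open>Hermite normal form of the lattice \<open>J\<close>: here \<open>c\<close> is the least
  positive coefficient of \<open>\<omega>\<close> in \<open>J\<close> and \<open>c * a\<close> the
  least positive rational integer in \<open>J\<close>. That \<open>c\<close> can be factored out and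
  that \<open>a\<close> divides the norm of \<open>b + \<omega>\<close> is due to \<open>J\<close>
  being an ideal rather than just a lattice.\<close>

lemma ideal_hermite_form:
  assumes J: "J \<subseteq> \<O>" and diff: "\<And>x y. x \<in> J \<Longrightarrow> y \<in> J \<Longrightarrow> x - y \<in> J"
    and mult: "\<And>r x. r \<in> \<O> \<Longrightarrow> x \<in> J \<Longrightarrow> r * x \<in> J"
    and z: "z \<in> J" "z \<noteq> 0"
  obtains a b c e :: int where "a > 0" "c > 0"
    "J = {of_int (c * m * a) + of_int (c * n) * (of_int b + \<omega>) | m n. True}"
    "(of_int b + \<omega>) * cnj (of_int b + \<omega>) = of_int (a * e)"
proof -
  have neg: "- x \<in> J" if "x \<in> J" for x
    using mult[of "of_int (- 1)", OF integer_of_int that] by simp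
  have add: "x + y \<in> J" if "x \<in> J" "y \<in> J" for x y
    using diff[OF that(1) neg[OF that(2)]] by simp
  have int_mult: "of_int k * x \<in> J" if "x \<in> J" for k x
    using mult[OF integer_of_int that] .
  obtain t0 n0 where "2 * Re \<omega> = of_int t0" "(cmod \<omega>)\<^sup>2 = of_int n0"
    using \<omega>_integer unfolding integer_iff by (meson Ints_cases)
  then have tn: "of_int t0 = \<omega> + cnj \<omega>" "of_int n0 = \<omega> * cnj \<omega>"
    using complex_add_cnj[of \<omega>] complex_norm_square[of \<omega>] by auto
  then have \<omega>2: "\<omega> * \<omega> = of_int t0 * \<omega> - of_int n0" by (simp add: algebra_simps)

  define P where "P n \<longleftrightarrow> n > 0 \<and> (\<exists>m. of_int m + of_int n * \<omega> \<in> J)" for n :: int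
  define Q where "Q n \<longleftrightarrow> n > 0 \<and> of_int n \<in> J" for n :: int
  have least: "\<exists>n. R n \<and> (\<forall>m. R m \<longrightarrow> n \<le> m)" if "\<exists>n. R n" "\<And>n. R n \<Longrightarrow> n > 0" for R :: "int \<Rightarrow> bool"
  proof -
    from that(1) obtain n where n: "R n" by blast
    obtain n' where "R n'" "\<And>m. R m \<Longrightarrow> nat n' \<le> nat m"
      using ex_has_least_nat[of R n nat, OF n] by blast
    then show ?thesis using that(2) by (intro exI[of _ n']) (force simp: nat_le_eq_zle)
  qed
  have exQ: "\<exists>n. Q n"
  proof -
    have "cnj z * z \<in> J" using mult[OF integer_cnj z(1)] z(1) J by blast
    then obtain n where n: "cnj z * z = of_int n"
      using real_integer[of "cnj z * z"] J by auto
    have "complex_of_real ((cmod z)\<^sup>2) = of_int n" unfolding complex_norm_square using n by (simp only: mult.commute)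
    then have "(cmod z)\<^sup>2 = of_int n" by (metis of_real_eq_iff of_real_of_int_eq)
    moreover have "(cmod z)\<^sup>2 > 0" using z(2) by simp
    ultimately have "n > 0" by simp
    then show ?thesis using \<open>cnj z * z \<in> J\<close> n unfolding Q_def by auto
  qed
  then obtain a0 where a0: "Q a0" "\<And>m. Q m \<Longrightarrow> a0 \<le> m" using least[of Q] Q_def by blast
  have "P a0"
    unfolding P_def using a0(1) mult[OF \<omega>_integer, of "of_int a0"]
    by (auto simp: Q_def mult.commute intro!: exI[of _ 0])
  then obtain c where c: "P c" "\<And>m. P m \<Longrightarrow> c \<le> m" using least[of P] P_def by blast
  then obtain b0 where b0: "of_int b0 + of_int c * \<omega> \<in> J" unfolding P_def by blast
  have pos: "a0 > 0" "c > 0" using a0(1) c(1) by (auto simp: P_def Q_def)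
  have a0_dvd: "a0 dvd m" if "of_int m \<in> J" for m
  proof -
    have "complex_of_int (m mod a0) = of_int m - of_int (m div a0) * of_int a0"
      by (simp add: minus_div_mult_eq_mod [symmetric])
    also have "\<dots> \<in> J" using that a0(1) by (intro diff int_mult) (auto simp: Q_def)
    finally have "of_int (m mod a0) \<in> J" .
    then have "\<not> m mod a0 > 0"
      using a0(2)[of "m mod a0"] pos_mod_bound[OF pos(1), of m] unfolding Q_def by linarith
    then show ?thesis using pos_mod_sign[OF pos(1), of m] by (simp add: dvd_eq_mod_eq_0)
  qed
  have c_dvd: "c dvd n" if "of_int m + of_int n * \<omega> \<in> J" for m n
  proof -
    have "of_int (m - (n div c) * b0) + of_int (n mod c) * \<omega>
        = of_int m + of_int n * \<omega> - of_int (n div c) * (of_int b0 + of_int c * \<omega>)"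
      by (simp add: minus_div_mult_eq_mod [symmetric] algebra_simps)
    also have "\<dots> \<in> J" using that b0 by (intro diff int_mult)
    finally have "of_int (m - (n div c) * b0) + of_int (n mod c) * \<omega> \<in> J" .
    then have "n mod c > 0 \<Longrightarrow> P (n mod c)" unfolding P_def by blast
    then have "\<not> n mod c > 0"
      using c(2)[of "n mod c"] pos_mod_bound[OF pos(2), of n] by linarith
    then show ?thesis using pos_mod_sign[OF pos(2), of n] by (simp add: dvd_eq_mod_eq_0)
  qed
  have "c dvd a0"
    using c_dvd[of 0 a0] mult[OF \<omega>_integer, of "of_int a0"] a0(1) by (simp add: Q_def mult.commute)
  then obtain a where a: "a0 = c * a" by blast
  \<comment> \<open>Multiplying the basis element by \<open>\<omega>\<close> stays in
    \<open>J\<close> and produces the coefficient \<open>b0 + c * t0\<close>, which \<open>c\<close>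
    must divide.\<close>
  have "of_int (- c * n0) + of_int (b0 + c * t0) * \<omega> = \<omega> * (of_int b0 + of_int c * \<omega>)"
  proof -
    have "\<omega> * (of_int b0 + of_int c * \<omega>) = of_int b0 * \<omega> + of_int c * (\<omega> * \<omega>)"
      by (simp add: algebra_simps)
    then show ?thesis unfolding \<omega>2 by (simp add: algebra_simps)
  qed
  also have "\<dots> \<in> J" using mult[OF \<omega>_integer b0] .
  finally have "c dvd b0 + c * t0" by (rule c_dvd)
  then have "c dvd b0" by (simp add: dvd_add_left_iff)
  then obtain b where b: "b0 = c * b" by blast
  define \<tau> where "\<tau> = of_int b + \<omega>"
  have \<tau>: "\<tau> \<in> \<O>" unfolding \<tau>_def by (intro integer_add) simp_all
  have c\<tau>: "of_int c * \<tau> \<in> J" using b0 by (simp add: b \<tau>_def algebra_simps)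
  have ca: "of_int (c * a) \<in> J" using a0(1) by (simp add: Q_def a)
  have "\<tau> * cnj \<tau> \<in> \<O>" using \<tau> by (intro integer_mult integer_cnj)
  then obtain e0 where e0: "\<tau> * cnj \<tau> = of_int e0" by (rule real_integer) simp
  \<comment> \<open>Multiplying \<open>c * \<tau>\<close> by \<open>cnj \<tau>\<close> gives a
    rational integer in \<open>J\<close>, hence a multiple of \<open>c * a\<close>.\<close>
  have "of_int (c * e0) = cnj \<tau> * (of_int c * \<tau>)" by (simp add: e0 [symmetric])
  also have "\<dots> \<in> J" using mult[OF integer_cnj[OF \<tau>] c\<tau>] .
  finally have "a0 dvd c * e0" by (rule a0_dvd)
  then have "a dvd e0" using pos(2) by (simp add: a)
  then obtain e where e: "e0 = a * e" by blast
  show thesis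
  proof (rule that)
    show "a > 0" using pos by (simp add: a zero_less_mult_iff)
    show "c > 0" by fact
    show "(of_int b + \<omega>) * cnj (of_int b + \<omega>) = of_int (a * e)"
      using e0 unfolding \<tau>_def e .
    show "J = {of_int (c * m * a) + of_int (c * n) * (of_int b + \<omega>) | m n. True}"
    proof (intro equalityI subsetI)
      fix x assume x: "x \<in> J"
      then obtain u v where uv: "x = of_int u + of_int v * \<omega>" using integer_expand J by blast
      then obtain n where n: "v = c * n" using c_dvd x by blast
      have "of_int (u - c * n * b) = x - of_int n * (of_int c * \<tau>)"
        by (simp add: uv n \<tau>_def algebra_simps)
      also have "\<dots> \<in> J" by (rule diff[OF x int_mult[OF c\<tau>]])
      finally obtain m where m: "u - c * n * b = a0 * m" using a0_dvd by blast
      have "x = of_int (u - c * n * b) + of_int (c * n) * (of_int b + \<omega>)"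
        by (simp add: uv n algebra_simps)
      also have "u - c * n * b = c * m * a" unfolding m a by simp
      finally show "x \<in> {of_int (c * m * a) + of_int (c * n) * (of_int b + \<omega>) | m n. True}" by blast
    next
      fix x assume "x \<in> {of_int (c * m * a) + of_int (c * n) * (of_int b + \<omega>) | m n. True}"
      then obtain m n where "x = of_int (c * m * a) + of_int (c * n) * (of_int b + \<omega>)" by blast
      then have "x = of_int m * of_int (c * a) + of_int n * (of_int c * \<tau>)"
        by (simp add: \<tau>_def algebra_simps)
      also have "\<dots> \<in> J" by (rule add[OF int_mult[OF ca] int_mult[OF c\<tau>]])
      finally show "x \<in> J" .
    qed
  qed
qed

text \<open>For \<open>J = c (\<int> a + \<int> \<tau>)\<close> the index is
  \<open>c\<^sup>2 * a\<close>. The products of basis elements with conjugates are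
  \<open>c\<^sup>2 * a\<close> times \<open>a\<close>, \<open>\<tau>\<close>,
  \<open>cnj \<tau>\<close> and \<open>e\<close>; these generate the unit ideal because
  \<open>a\<close>, the trace of \<open>\<tau>\<close> and \<open>e\<close> have no common
  factor.\<close>

lemma ideal_has_norm:
  assumes J: "J \<subseteq> \<O>" and diff: "\<And>x y. x \<in> J \<Longrightarrow> y \<in> J \<Longrightarrow> x - y \<in> J"
    and mult: "\<And>r x. r \<in> \<O> \<Longrightarrow> x \<in> J \<Longrightarrow> r * x \<in> J"
    and z: "z \<in> J" "z \<noteq> 0"
  shows "has_norm J (integral_ideal_norm K J)"
proof -
  obtain a b c e where pos: "a > 0" "c > 0"
    and J_eq: "J = {of_int (c * m * a) + of_int (c * n) * (of_int b + \<omega>) | m n. True}"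
    and norm: "(of_int b + \<omega>) * cnj (of_int b + \<omega>) = of_int (a * e)"
    by (rule ideal_hermite_form[OF assms])
  define \<tau> where "\<tau> = of_int b + \<omega>"
  have \<tau>: "\<tau> \<in> \<O>" unfolding \<tau>_def by (intro integer_add) simp_all
  have norm: "\<tau> * cnj \<tau> = of_int (a * e)" using norm unfolding \<tau>_def .
  have J_iff: "x \<in> J \<longleftrightarrow> (\<exists>m n. x = of_int (c * m * a) + of_int (c * n) * \<tau>)" for x
    unfolding J_eq \<tau>_def by blast
  define N where "N = c\<^sup>2 * a"
  have "N > 0" using pos by (simp add: N_def)

  have "integral_ideal_norm K J = nat N"
  proof -
    define R where "R = {(x, y). x \<in> \<O> \<and> y \<in> \<O> \<and> x - y \<in> J}"
    define f where "f = (\<lambda>(p, q). R `` {of_int p + of_int q * \<omega>})"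
    have mem: "of_int p + of_int q * \<omega> \<in> \<O>" for p q
      by (intro integer_add integer_mult) simp_all
    have zero: "0 \<in> J" using diff[OF z(1) z(1)] by simp
    have sym: "y - x \<in> J" if "x - y \<in> J" for x y
      using diff[OF zero that] by simp
    have class_eq: "R `` {x} = R `` {y} \<longleftrightarrow> x - y \<in> J" if "x \<in> \<O>" "y \<in> \<O>" for x y
    proof
      assume "R `` {x} = R `` {y}"
      moreover have "y \<in> R `` {y}" using that zero by (simp add: R_def)
      ultimately show "x - y \<in> J" by (auto simp: R_def)
    next
      assume xy: "x - y \<in> J"
      have "x - w \<in> J \<longleftrightarrow> y - w \<in> J" for w
        using diff[OF _ xy, of "x - w"] diff[OF _ sym[OF xy], of "y - w"] by auto
      then show "R `` {x} = R `` {y}" using that by (auto simp: R_def)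
    qed
    have lattice: "of_int u + of_int v * \<omega> \<in> J \<longleftrightarrow> (\<exists>m n. u = c * m * a + c * n * b \<and> v = c * n)" for u v
    proof
      assume "of_int u + of_int v * \<omega> \<in> J"
      then obtain m n where "of_int u + of_int v * \<omega> = of_int (c * m * a) + of_int (c * n) * \<tau>"
        using J_iff by blast
      then have "of_int u + of_int v * \<omega> = of_int (c * m * a + c * n * b) + of_int (c * n) * \<omega>"
        by (simp add: \<tau>_def algebra_simps)
      then show "\<exists>m n. u = c * m * a + c * n * b \<and> v = c * n"
        using expansion_unique by blast
    next
      assume "\<exists>m n. u = c * m * a + c * n * b \<and> v = c * n"
      then obtain m n where "u = c * m * a + c * n * b" "v = c * n" by blast
      then have "of_int u + of_int v * \<omega> = of_int (c * m * a) + of_int (c * n) * \<tau>"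
        by (simp add: \<tau>_def algebra_simps)
      then show "of_int u + of_int v * \<omega> \<in> J" using J_iff by blast
    qed
    have close: "i = j" if "k dvd i - j" "i \<in> {0..<k}" "j \<in> {0..<k}" for i j k :: int
      using that by (metis atLeastLessThan_iff mod_eq_dvd_iff mod_pos_pos_trivial)
    \<comment> \<open>The elements \<open>p + q * \<omega>\<close> with
      \<open>0 \<le> p < c * a\<close> and \<open>0 \<le> q < c\<close> represent each class once:
      first \<open>q\<close> is reduced modulo \<open>c\<close>, then \<open>p\<close> modulo
      \<open>c * a\<close>.\<close>
    have "bij_betw f ({0..<c * a} \<times> {0..<c}) (\<O> // R)"
      unfolding bij_betw_def
    proof
      show "inj_on f ({0..<c * a} \<times> {0..<c})"
      proof (rule inj_onI, clarify)
        fix p q p' q' assume pq: "p \<in> {0..<c * a}" "q \<in> {0..<c}" "p' \<in> {0..<c * a}" "q' \<in> {0..<c}"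
        assume "f (p, q) = f (p', q')"
        then have "of_int p + of_int q * \<omega> - (of_int p' + of_int q' * \<omega>) \<in> J"
          using class_eq mem by (simp add: f_def)
        then have "of_int (p - p') + of_int (q - q') * \<omega> \<in> J" by (simp add: algebra_simps)
        then obtain m n where mn: "p - p' = c * m * a + c * n * b" "q - q' = c * n"
          using lattice by blast
        then have "q = q'" using close[of c q q'] pq by simp
        then have "n = 0" using mn(2) pos by simp
        then have "c * a dvd p - p'" using mn(1) by simp
        then show "p = p' \<and> q = q'" using close[of "c * a" p p'] pq \<open>q = q'\<close> by simp
      qed
      show "f ` ({0..<c * a} \<times> {0..<c}) = \<O> // R"
      proof (intro equalityI subsetI)
        fix X assume "X \<in> f ` ({0..<c * a} \<times> {0..<c})"
        then show "X \<in> \<O> // R" using mem by (auto simp: f_def quotient_def)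
      next
        fix X assume "X \<in> \<O> // R"
        then obtain x where x: "x \<in> \<O>" "X = R `` {x}" by (auto simp: quotient_def)
        obtain u v where uv: "x = of_int u + of_int v * \<omega>" using integer_expand[OF x(1)] .
        define n q where "n = v div c" and "q = v mod c"
        define m p where "m = (u - c * n * b) div (c * a)" and "p = (u - c * n * b) mod (c * a)"
        have v: "v = c * n + q" by (simp add: n_def q_def)
        have u: "u = c * a * m + p + c * n * b" by (simp add: m_def p_def)
        have "c * a > 0" using pos by simp
        then have pq: "p \<in> {0..<c * a}" "q \<in> {0..<c}"
          using pos by (simp_all add: p_def q_def)
        have "of_int (c * m * a + c * n * b) + of_int (c * n) * \<omega> \<in> J"
          using lattice by blast
        then have "x - (of_int p + of_int q * \<omega>) \<in> J"
          by (simp add: uv u v algebra_simps)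
        then have "X = f (p, q)" using class_eq x mem by (simp add: f_def)
        then show "X \<in> f ` ({0..<c * a} \<times> {0..<c})" using pq by blast
      qed
    qed
    then have "card (\<O> // R) = card ({0..<c * a} \<times> {0..<c})"
      using bij_betw_same_card by metis
    also have "\<dots> = nat N"
      using pos by (simp add: card_cartesian_product N_def nat_mult_distrib power2_eq_square mult_ac)
    finally show ?thesis by (simp add: integral_ideal_norm_def R_def)
  qed
  then have card: "real (integral_ideal_norm K J) = of_int N" using \<open>N > 0\<close> by simp

  have products: "x * cnj y / of_int N \<in> \<O>" if "x \<in> J" "y \<in> J" for x y
  proof -
    from that obtain m n m' n' where x: "x = of_int (c * m * a) + of_int (c * n) * \<tau>"
      and y: "y = of_int (c * m' * a) + of_int (c * n') * \<tau>"
      using J_iff by blast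
    define r where "r = of_int (m * m' * a + n * n' * e) + of_int (m * n') * cnj \<tau> + of_int (n * m') * \<tau>"
    have "x * cnj y = of_int (c\<^sup>2 * a * m * m' * a) + of_int (c\<^sup>2 * a * m * n') * cnj \<tau>
        + of_int (c\<^sup>2 * a * n * m') * \<tau> + of_int (c\<^sup>2 * n * n') * (\<tau> * cnj \<tau>)"
      unfolding x y by (simp add: algebra_simps power2_eq_square)
    also have "\<dots> = of_int N * r"
      unfolding norm r_def N_def by (simp add: algebra_simps)
    finally have "x * cnj y / of_int N = r" using \<open>N > 0\<close> by simp
    moreover have "r \<in> \<O>"
      unfolding r_def by (intro integer_add integer_mult integer_cnj integer_of_int \<tau>)
    ultimately show ?thesis by simp
  qed

  have "2 * Re \<tau> \<in> \<int>" using \<tau> unfolding integer_iff by blast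
  then obtain t where t: "2 * Re \<tau> = of_int t" by (auto elim: Ints_cases)
  then have t': "of_int t = \<tau> + cnj \<tau>" using complex_add_cnj[of \<tau>] by auto
  define g where "g = gcd (gcd a t) e"
  have "g > 0" using pos by (simp add: g_def)
  txt \<open>Primitivity: \<open>\<tau> / g\<close> has integral trace and norm, but the coefficient of \<open>\<omega>\<close> in it is \<open>1 / g\<close>.\<close>
  have "g = 1"
  proof -
    have "g dvd a" "g dvd t" "g dvd e"
      unfolding g_def by (auto intro: dvd_trans[OF gcd_dvd1])
    then obtain a' t' e' where g: "a = g * a'" "t = g * t'" "e = g * e'"
      unfolding dvd_def by blast
    have "(cmod (\<tau> / of_int g))\<^sup>2 = of_int (a' * e')"
    proof -
      have "complex_of_real ((cmod \<tau>)\<^sup>2) = of_int (a * e)"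
        unfolding complex_norm_square norm ..
      then have "(cmod \<tau>)\<^sup>2 = of_int (a * e)" by (metis of_real_eq_iff of_real_of_int_eq)
      then show ?thesis
        using \<open>g > 0\<close> unfolding g by (simp add: norm_divide power_divide power2_eq_square)
    qed
    moreover have "2 * Re (\<tau> / of_int g) = of_int t'"
      using t \<open>g > 0\<close> Re_divide_of_real[of \<tau> "of_int g"] unfolding g by (simp add: field_simps)
    moreover have "\<tau> / of_int g \<in> K"
      using \<tau> by (intro subfield_divide[OF subfield] subfield_of_int[OF subfield] integer_field)
    ultimately have "\<tau> / of_int g \<in> \<O>" unfolding integer_iff by simp
    then obtain m n where "\<tau> / of_int g = of_int m + of_int n * \<omega>" by (rule integer_expand)
    then have "of_int b + of_int 1 * \<omega> = of_int (g * m) + of_int (g * n) * \<omega>"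
      using \<open>g > 0\<close> by (simp add: \<tau>_def field_simps)
    then have "1 = g * n" by (rule expansion_unique)
    then have "g * n = 1" by simp
    then show ?thesis using \<open>g > 0\<close> by (simp add: zmult_eq_1_iff)
  qed
  obtain y1 y2 where y: "y1 * a + y2 * t = gcd a t" using bezout_int by blast
  obtain y3 y4 where y': "y3 * gcd a t + y4 * e = 1" using bezout_int \<open>g = 1\<close> unfolding g_def by metis
  have bezout: "(y3 * y1) * a + (y3 * y2) * t + y4 * e = 1"
    using y' unfolding y [symmetric] by (simp add: algebra_simps)
  define w1 w2 where "w1 = complex_of_int (c * a)" and "w2 = of_int c * \<tau>"
  \<comment> \<open>Chosen so that the Bezout coefficients weight \<open>w1 * cnj w1\<close>, the
    trace of \<open>w1 * cnj w2\<close> and \<open>w2 * cnj w2\<close>, which are \<open>N\<close>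
    times \<open>a\<close>, \<open>t\<close> and \<open>e\<close>.\<close>
  define s1 s2 where "s1 = of_int (y3 * y1) * w1 + of_int (y3 * y2) * w2"
    and "s2 = of_int (y3 * y2) * w1 + of_int y4 * w2"
  have comb: "of_int m * w1 + of_int n * w2 \<in> J" for m n
    unfolding J_iff w1_def w2_def by (rule exI[of _ m], rule exI[of _ n]) simp
  have mem: "w1 \<in> J" "w2 \<in> J" "s1 \<in> J" "s2 \<in> J"
    using comb[of 1 0] comb[of 0 1] comb unfolding s1_def s2_def by (simp, simp, blast+)
  have "w1 * cnj s1 + w2 * cnj s2
      = of_int (c\<^sup>2 * a) * (of_int (y3 * y1 * a) + of_int (y3 * y2) * (\<tau> + cnj \<tau>))
        + of_int (c\<^sup>2 * y4) * (\<tau> * cnj \<tau>)"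
    unfolding s1_def s2_def w1_def w2_def by (simp add: algebra_simps power2_eq_square)
  also have "\<dots> = of_int (N * ((y3 * y1) * a + (y3 * y2) * t + y4 * e))"
    unfolding norm t' [symmetric] N_def by (simp add: algebra_simps)
  also have "\<dots> = of_int N" unfolding bezout by simp
  finally have "of_int N = w1 * cnj s1 + w2 * cnj s2" by simp
  then show ?thesis
    unfolding has_norm_def card of_real_of_int_eq
    using mem products \<open>N > 0\<close> by auto
qed

text \<open>Every admissible denominator yields a number satisfying \<open>has_norm I\<close>, and
  there is only one such number. So the definite description in \<open>ideal_norm\<close> does not
  depend on the denominator.\<close>

lemma ideal_norm_has_norm:
  assumes diff: "\<And>x y. x \<in> I \<Longrightarrow> y \<in> I \<Longrightarrow> x - y \<in> I"
    and mult: "\<And>r x. r \<in> \<O> \<Longrightarrow> x \<in> I \<Longrightarrow> r * x \<in> I"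
    and z: "z \<in> I" "z \<noteq> 0"
    and den: "d \<in> \<O>" "d \<noteq> 0" "(*) d ` I \<subseteq> \<O>"
  shows "has_norm I (ideal_norm K I)"
proof -
  have norm: "has_norm I (integral_ideal_norm K ((*) d ` I) / (cmod d)\<^sup>2)"
    if "d \<noteq> 0" "(*) d ` I \<subseteq> \<O>" for d
  proof (rule has_norm_scale[OF ideal_has_norm[OF that(2)] that(1)])
    show "x - y \<in> (*) d ` I" if "x \<in> (*) d ` I" "y \<in> (*) d ` I" for x y
      using that diff by (auto simp flip: right_diff_distrib)
    show "r * x \<in> (*) d ` I" if "r \<in> \<O>" "x \<in> (*) d ` I" for r x
      using that mult by (auto simp: mult.left_commute)
    show "d * z \<in> (*) d ` I" "d * z \<noteq> 0" using z that(1) by auto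
  qed
  let ?q = "integral_ideal_norm K ((*) d ` I) / (cmod d)\<^sup>2"
  have "ideal_norm K I = ?q"
    unfolding ideal_norm_def
  proof (rule the_equality)
    show "\<exists>d\<in>\<O>. d \<noteq> 0 \<and> (*) d ` I \<subseteq> \<O> \<and> ?q = real (integral_ideal_norm K ((*) d ` I)) / (cmod d)\<^sup>2"
      using den by blast
  next
    fix q assume "\<exists>d\<in>\<O>. d \<noteq> 0 \<and> (*) d ` I \<subseteq> \<O> \<and> q = real (integral_ideal_norm K ((*) d ` I)) / (cmod d)\<^sup>2"
    then have "has_norm I q" using norm by blast
    then show "q = ?q" using has_norm_unique norm[OF den(2,3)] by blast
  qed
  then show ?thesis using norm[OF den(2,3)] by simp
qed

section \<open>The ideal generated by the entries of a matrix\<close>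

lemma entries_ideal_eq:
  "entries_ideal K M = {r * M$1$1 + s * M$1$2 + (t * M$2$1 + u * M$2$2) | r s t u.
     r \<in> \<O> \<and> s \<in> \<O> \<and> t \<in> \<O> \<and> u \<in> \<O>}"
proof (intro equalityI subsetI)
  fix x assume "x \<in> entries_ideal K M"
  then show "x \<in> {r * M$1$1 + s * M$1$2 + (t * M$2$1 + u * M$2$2) | r s t u.
     r \<in> \<O> \<and> s \<in> \<O> \<and> t \<in> \<O> \<and> u \<in> \<O>}"
    unfolding entries_ideal_def sum_2 by blast
next
  fix x assume "x \<in> {r * M$1$1 + s * M$1$2 + (t * M$2$1 + u * M$2$2) | r s t u.
     r \<in> \<O> \<and> s \<in> \<O> \<and> t \<in> \<O> \<and> u \<in> \<O>}"
  then obtain r s t u where x: "x = r * M$1$1 + s * M$1$2 + (t * M$2$1 + u * M$2$2)"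
    and mem: "r \<in> \<O>" "s \<in> \<O>" "t \<in> \<O>" "u \<in> \<O>" by blast
  define A :: "complex^2^2" where "A = vector [vector [r, s], vector [t, u]]"
  have "x = (\<Sum>i\<in>UNIV. \<Sum>j\<in>UNIV. A $ i $ j * M $ i $ j)"
    by (simp add: sum_2 A_def x)
  moreover have "\<forall>i j. A $ i $ j \<in> \<O>" by (simp add: forall_2 A_def mem)
  ultimately show "x \<in> entries_ideal K M" unfolding entries_ideal_def by blast
qed

lemma entries_ideal_mem: "M $ i $ j \<in> entries_ideal K M"
proof -
  have "\<forall>i j. M $ i $ j \<in> entries_ideal K M"
    unfolding entries_ideal_eq forall_2 mem_Collect_eq
    apply (intro conjI)
    subgoal by (rule exI[of _ 1], rule exI[of _ 0], rule exI[of _ 0], rule exI[of _ 0]) simp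
    subgoal by (rule exI[of _ 0], rule exI[of _ 1], rule exI[of _ 0], rule exI[of _ 0]) simp
    subgoal by (rule exI[of _ 0], rule exI[of _ 0], rule exI[of _ 1], rule exI[of _ 0]) simp
    subgoal by (rule exI[of _ 0], rule exI[of _ 0], rule exI[of _ 0], rule exI[of _ 1]) simp
    done
  then show ?thesis by blast
qed

lemma entries_ideal_has_norm:
  assumes M: "\<And>i j. M $ i $ j \<in> K" and nz: "M $ k $ l \<noteq> 0"
  shows "has_norm (entries_ideal K M) (ideal_norm K (entries_ideal K M))"
proof -
  have "\<forall>i j. \<exists>m::int. m > 0 \<and> of_int m * M $ i $ j \<in> \<O>"
    using denominator[OF M] by blast
  then obtain d :: "2 \<Rightarrow> 2 \<Rightarrow> int" where d: "\<And>i j. d i j > 0" "\<And>i j. of_int (d i j) * M $ i $ j \<in> \<O>"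
    by metis
  \<comment> \<open>The product of the four denominators is a common denominator of the
    entries.\<close>
  define e where "e = d 1 1 * d 1 2 * (d 2 1 * d 2 2)"
  have "e > 0" using d(1) by (simp add: e_def)
  have "of_int e * M$1$1 = of_int (d 1 2 * (d 2 1 * d 2 2)) * (of_int (d 1 1) * M$1$1)"
    "of_int e * M$1$2 = of_int (d 1 1 * (d 2 1 * d 2 2)) * (of_int (d 1 2) * M$1$2)"
    "of_int e * M$2$1 = of_int (d 1 1 * d 1 2 * d 2 2) * (of_int (d 2 1) * M$2$1)"
    "of_int e * M$2$2 = of_int (d 1 1 * d 1 2 * d 2 1) * (of_int (d 2 2) * M$2$2)"
    by (simp_all add: e_def mult_ac)
  then have "\<forall>i j. of_int e * M $ i $ j \<in> \<O>"
    unfolding forall_2 using integer_mult[OF integer_of_int d(2)] by metis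
  then have e: "of_int e * M $ i $ j \<in> \<O>" for i j by blast
  show ?thesis
  proof (rule ideal_norm_has_norm[OF _ _ entries_ideal_mem nz])
    fix x y assume "x \<in> entries_ideal K M" "y \<in> entries_ideal K M"
    then obtain r s t u r' s' t' u' where
      x: "x = r * M$1$1 + s * M$1$2 + (t * M$2$1 + u * M$2$2)"
      and y: "y = r' * M$1$1 + s' * M$1$2 + (t' * M$2$1 + u' * M$2$2)"
      and mem: "r \<in> \<O>" "s \<in> \<O>" "t \<in> \<O>" "u \<in> \<O>" "r' \<in> \<O>" "s' \<in> \<O>" "t' \<in> \<O>" "u' \<in> \<O>"
      unfolding entries_ideal_eq by blast
    have "x - y = (r - r') * M$1$1 + (s - s') * M$1$2 + ((t - t') * M$2$1 + (u - u') * M$2$2)"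
      unfolding x y by (simp add: algebra_simps)
    then show "x - y \<in> entries_ideal K M"
      unfolding entries_ideal_eq using mem integer_diff by blast
  next
    fix c x assume c: "c \<in> \<O>" and "x \<in> entries_ideal K M"
    then obtain r s t u where
      x: "x = r * M$1$1 + s * M$1$2 + (t * M$2$1 + u * M$2$2)"
      and mem: "r \<in> \<O>" "s \<in> \<O>" "t \<in> \<O>" "u \<in> \<O>"
      unfolding entries_ideal_eq by blast
    have "c * x = (c * r) * M$1$1 + (c * s) * M$1$2 + ((c * t) * M$2$1 + (c * u) * M$2$2)"
      unfolding x by (simp add: algebra_simps)
    then show "c * x \<in> entries_ideal K M"
      unfolding entries_ideal_eq using mem c integer_mult by blast
  next
    show "of_int e \<in> \<O>" "complex_of_int e \<noteq> 0" using \<open>e > 0\<close> by simp_all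
    show "(*) (of_int e) ` entries_ideal K M \<subseteq> \<O>"
    proof
      fix x assume "x \<in> (*) (of_int e) ` entries_ideal K M"
      then obtain r s t u where
        x: "x = of_int e * (r * M$1$1 + s * M$1$2 + (t * M$2$1 + u * M$2$2))"
        and mem: "r \<in> \<O>" "s \<in> \<O>" "t \<in> \<O>" "u \<in> \<O>"
        unfolding entries_ideal_eq by blast
      have "x = r * (of_int e * M$1$1) + s * (of_int e * M$1$2)
          + (t * (of_int e * M$2$1) + u * (of_int e * M$2$2))"
        unfolding x by (simp add: algebra_simps)
      also have "\<dots> \<in> \<O>" using mem by (intro integer_add integer_mult[OF _ e])
      finally show "x \<in> \<O>" .
    qed
  qed
qed

section \<open>Circles and Hermitian forms\<close>

text \<open>The condition on the conjugate of the curvature-center follows from the one on the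
  curvature-center, since \<open>\<i> * sqrt D\<close> is purely imaginary and conjugation preserves
  \<open>\<O>\<close>.\<close>

lemma circle_family_iff:
  assumes "D > 0" "C \<in> oriented_circles"
  shows "C \<in> circle_family K D \<longleftrightarrow>
    \<i> * of_real (sqrt D) * curvature_center C \<in> \<O> \<and>
    (\<exists>n::int. \<i> * of_real (sqrt D) * of_real (cocurvature C) = sqrt_discriminant K * of_int n) \<and>
    (\<exists>n::int. \<i> * of_real (sqrt D) * of_real (curvature C) = sqrt_discriminant K * of_int n)"
proof -
  have "csqrt (of_real D) = of_real (sqrt D)"
    using assms(1) by (simp add: csqrt_of_real_nonneg)
  moreover have "\<i> * of_real (sqrt D) * cnj z \<in> \<O>" if "\<i> * of_real (sqrt D) * z \<in> \<O>" for z
  proof -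
    have "\<i> * of_real (sqrt D) * cnj z = - cnj (\<i> * of_real (sqrt D) * z)" by simp
    then show ?thesis using integer_uminus[OF integer_cnj[OF that]] by simp
  qed
  ultimately show ?thesis
    using assms(2) unfolding circle_family_def circle_vector_def Let_def by auto
qed

text \<open>Since the discriminant is minus a square of a real number, a solution with
  \<open>x \<noteq> 0\<close> exhibits \<open>D\<close> as the norm of
  \<open>(z + y * sqrt \<Delta>) / x\<close>. With \<open>x = 0\<close> a sum of two squares would
  vanish, leaving only the zero solution.\<close>

lemma norm_form:
  assumes "D \<noteq> 0" "hilbert_symbol D (of_int (field_discriminant K)) = 1"
  obtains l where "l \<in> K" "l * cnj l = of_real D"
proof -
  obtain x y z :: rat where xyz: "(x, y, z) \<noteq> (0, 0, 0)"
    and eq: "D * (of_rat x)\<^sup>2 + of_int (field_discriminant K) * (of_rat y)\<^sup>2 = (of_rat z)\<^sup>2"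
    using assms(2) unfolding hilbert_symbol_def by (auto split: if_splits)
  have eq': "D * (of_rat x)\<^sup>2 = (of_rat z)\<^sup>2 + (2 * Im \<omega> * of_rat y)\<^sup>2"
    using eq unfolding field_discriminant by (simp add: algebra_simps power_mult_distrib)
  have "x \<noteq> 0"
  proof
    assume "x = 0"
    then have "(of_rat z)\<^sup>2 + (2 * Im \<omega> * of_rat y)\<^sup>2 = 0" using eq' by simp
    then have "of_rat z = (0::real)" "2 * Im \<omega> * of_rat y = 0"
      by (simp_all only: sum_power2_eq_zero_iff)
    then show False using xyz \<open>x = 0\<close> Im_\<omega>_pos by simp
  qed
  define l where "l = (of_rat z + of_rat y * sqrt_discriminant K) / of_rat x"
  have "of_rat z + of_rat y * sqrt_discriminant K = Complex (of_rat z) (2 * Im \<omega> * of_rat y)"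
    by (simp add: sqrt_discriminant complex_eq_iff flip: of_real_of_rat_complex)
  moreover define X :: real where "X = of_rat x"
  ultimately have "l = Complex (of_rat z) (2 * Im \<omega> * of_rat y) / of_real X"
    by (simp add: l_def of_real_of_rat_complex)
  moreover have "X \<noteq> 0" using \<open>x \<noteq> 0\<close> by (simp add: X_def)
  moreover have "(cmod (Complex (of_rat z) (2 * Im \<omega> * of_rat y) / of_real X))\<^sup>2
      = ((of_rat z)\<^sup>2 + (2 * Im \<omega> * of_rat y)\<^sup>2) / X\<^sup>2"
    by (simp add: norm_divide power_divide complex_norm)
  ultimately have "(cmod l)\<^sup>2 = D"
    by (simp add: eq' [folded X_def, symmetric])
  then have "l * cnj l = of_real D" using complex_norm_square[of l] by simp
  moreover have "l \<in> K"
    unfolding l_def sqrt_discriminant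
    by (intro subfield_divide subfield_add subfield_mult subfield_diff subfield subfield_of_rat
        cnj_field integer_field \<omega>_integer)
  ultimately show thesis by (rule that[rotated])
qed

text \<open>As \<open>\<bar>det M\<bar> = N * sqrt D\<close>, multiplying the parameters by
  \<open>\<i> * sqrt D\<close> leaves differences of products \<open>x * cnj y / N\<close> of
  entries. These lie in \<open>\<O>\<close>; for the curvature and cocurvature each is an integer
  minus its conjugate, up to sign.\<close>

lemma image_in_circle_family:
  assumes "D > 0" "M \<in> GL2 K"
    and det: "cmod (det M) / ideal_norm K (entries_ideal K M) = sqrt D"
  shows "image_of_real_line M \<in> circle_family K D"
proof -
  define \<alpha> \<beta> \<gamma> \<delta> where "\<alpha> = M $ 1 $ 1" and "\<beta> = M $ 2 $ 1" and "\<gamma> = M $ 1 $ 2" and "\<delta> = M $ 2 $ 2"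
  note entries = \<alpha>_def \<beta>_def \<gamma>_def \<delta>_def
  define N where "N = ideal_norm K (entries_ideal K M)"
  have M: "M $ i $ j \<in> K" "det M \<noteq> 0" for i j using assms(2) by (auto simp: GL2_def)
  have "\<exists>k l. M $ k $ l \<noteq> 0" using M(2) unfolding det_2 by (metis diff_self mult_zero_left)
  then have "has_norm (entries_ideal K M) N" unfolding N_def using entries_ideal_has_norm M(1) by blast
  then have N: "N > 0" "\<And>x y. x \<in> entries_ideal K M \<Longrightarrow> y \<in> entries_ideal K M \<Longrightarrow> x * cnj y / of_real N \<in> \<O>"
    unfolding has_norm_def by blast+
  have products: "\<alpha> * cnj \<delta> / of_real N \<in> \<O>" "\<gamma> * cnj \<beta> / of_real N \<in> \<O>"
    "\<alpha> * cnj \<gamma> / of_real N \<in> \<O>" "\<beta> * cnj \<delta> / of_real N \<in> \<O>"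
    unfolding entries by (intro N(2) entries_ideal_mem)+
  have det: "cmod (det M) = N * sqrt D" using det N(1) unfolding N_def by (simp add: field_simps)
  have scale: "\<i> * of_real (sqrt D) * (\<i> * z / of_real (N * sqrt D)) = - (z / of_real N)" for z
    using assms(1) by (simp add: field_simps)
  have curv: "\<exists>n::int. \<i> * of_real (sqrt D) * of_real (Re (\<i> * (x * cnj y - cnj x * y) / of_real (N * sqrt D)))
      = sqrt_discriminant K * of_int n" if "x * cnj y / of_real N \<in> \<O>" for x y
  proof -
    have real: "of_real (Re (\<i> * (x * cnj y - cnj x * y) / of_real (N * sqrt D)))
        = \<i> * (x * cnj y - cnj x * y) / of_real (N * sqrt D)"
      by (rule complex_eqI) (simp_all add: algebra_simps)
    obtain n where n: "x * cnj y / of_real N - cnj (x * cnj y / of_real N) = sqrt_discriminant K * of_int n"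
      by (rule diff_cnj[OF \<open>x * cnj y / of_real N \<in> \<O>\<close>])
    have "- ((x * cnj y - cnj x * y) / of_real N) = sqrt_discriminant K * of_int (- n)"
      using n by (simp add: diff_divide_distrib)
    then show ?thesis unfolding real scale by blast
  qed
  have image: "image_of_real_line M = \<lparr> curvature_center = \<i> * (\<alpha> * cnj \<delta> - cnj \<beta> * \<gamma>) / of_real (N * sqrt D),
      cocurvature = Re (\<i> * (\<alpha> * cnj \<gamma> - cnj \<alpha> * \<gamma>) / of_real (N * sqrt D)),
      curvature = Re (\<i> * (\<beta> * cnj \<delta> - cnj \<beta> * \<delta>) / of_real (N * sqrt D)) \<rparr>"
    unfolding image_of_real_line_def Let_def det entries ..
  have "- ((\<alpha> * cnj \<delta> - cnj \<beta> * \<gamma>) / of_real N) = \<gamma> * cnj \<beta> / of_real N - \<alpha> * cnj \<delta> / of_real N"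
    by (simp add: diff_divide_distrib mult.commute)
  then have "- ((\<alpha> * cnj \<delta> - cnj \<beta> * \<gamma>) / of_real N) \<in> \<O>"
    using products by (simp add: integer_diff)
  then show ?thesis
    unfolding circle_family_iff[OF assms(1) image_of_real_line_in_oriented_circles[OF M(2)]]
    unfolding image circle_params.simps scale
    using curv products by blast
qed

text \<open>
  The isotropic vectors of the Hermitian form of \<open>C\<close> are the points of \<open>C\<close>; here they are found by
  completing the square.
\<close>
lemma isotropic_vector:
  assumes K: "B \<in> K" "E \<in> K" "l \<in> K"
    and skew: "cnj A = - A" "cnj E = - E"
    and disc: "A * E + B * cnj B = l * cnj l"
  obtains \<alpha> \<beta> where "\<alpha> \<in> K" "\<beta> \<in> K" "\<alpha> \<noteq> 0 \<or> \<beta> \<noteq> 0"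
    "\<beta> * cnj \<beta> * A - \<beta> * cnj \<alpha> * B + \<alpha> * cnj \<beta> * cnj B + \<alpha> * cnj \<alpha> * E = 0"
proof (cases "E = 0")
  case True
  show thesis
    by (rule that[of 1 0]) (use True subfield_1 subfield_0 subfield in auto)
next
  case False
  \<comment> \<open>With \<open>\<beta> = 1\<close> and \<open>w = \<alpha> * E\<close>, the form
    times \<open>E\<close> equals \<open>A * E + B * cnj B - (w - B) * cnj (w - B)\<close>, because
    \<open>cnj E = - E\<close>. Taking \<open>w = l + B\<close> makes it vanish.\<close>
  define \<alpha> where "\<alpha> = (l + B) / E"
  have "A - cnj \<alpha> * B + \<alpha> * cnj B + \<alpha> * cnj \<alpha> * E = (A * E + B * cnj B - l * cnj l) / E"
    using False unfolding \<alpha>_def complex_cnj_divide complex_cnj_add skew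
    by (simp add: field_simps)
  then have "A - cnj \<alpha> * B + \<alpha> * cnj B + \<alpha> * cnj \<alpha> * E = 0" unfolding disc by simp
  moreover have "\<alpha> \<in> K"
    unfolding \<alpha>_def by (intro subfield_divide subfield_add subfield K)
  ultimately show thesis
    by (intro that[of \<alpha> 1]) (use subfield_1 subfield in auto)
qed

end

text \<open>
  Primed letters stand for complex conjugates. If \<open>(\<alpha>, \<beta>)\<close> is isotropic for the skew-Hermitian
  matrix with rows \<open>(A, B)\<close> and \<open>(- B', E)\<close>, then the columns \<open>(\<alpha>, \<beta>)\<close> and
  \<open>(x * \<alpha> - y * Q' / N, x * \<beta> + y * P' / N)\<close> transform the standard symplectic form into \<open>N\<close>
  times that matrix.
\<close>
lemma second_column_identities:
  fixes N :: "'a :: comm_ring_1"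
  assumes N: "\<alpha> * P' + \<beta> * Q' = N" "\<alpha>' * P + \<beta>' * Q = N"
    and iso: "\<beta> * \<beta>' * A - \<beta> * \<alpha>' * B + \<alpha> * \<beta>' * B' + \<alpha> * \<alpha>' * E = 0"
    and y: "y = \<beta> * A * P + \<beta> * B * Q + \<alpha> * B' * P - \<alpha> * E * Q"
    and y': "y' = - \<beta>' * A * P' + \<beta>' * B' * Q' + \<alpha>' * B * P' + \<alpha>' * E * Q'"
    and x: "N * (x' - x) = P * P' * A + P' * Q * B - Q' * P * B' + Q * Q' * E"
  shows "\<alpha> * (N * x' * \<alpha>' - y' * Q) - \<alpha>' * (N * x * \<alpha> - y * Q') = N * N * A"
    and "\<alpha> * (N * x' * \<beta>' + y' * P) - \<beta>' * (N * x * \<alpha> - y * Q') = N * N * B"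
    and "\<beta> * (N * x' * \<beta>' + y' * P) - \<beta>' * (N * x * \<beta> + y * P') = N * N * E"
proof -
  \<comment> \<open>Each left side differs from its target by a multiple of \<open>?h\<close>, which
    is zero by \<open>iso\<close>. Expanding \<open>N * N\<close> through both relations for
    \<open>N\<close> makes this visible.\<close>
  let ?h = "\<beta> * \<beta>' * A - \<beta> * \<alpha>' * B + \<alpha> * \<beta>' * B' + \<alpha> * \<alpha>' * E"
  have NN: "N * N = (\<alpha> * P' + \<beta> * Q') * (\<alpha>' * P + \<beta>' * Q)" by (simp only: N)
  have "\<alpha> * (N * x' * \<alpha>' - y' * Q) - \<alpha>' * (N * x * \<alpha> - y * Q')
      = \<alpha> * \<alpha>' * (N * (x' - x)) - \<alpha> * y' * Q + \<alpha>' * y * Q'" by (simp add: algebra_simps)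
  also have "\<dots> = N * N * A - Q * Q' * ?h"
    unfolding x y y' NN by (simp add: algebra_simps)
  finally show "\<alpha> * (N * x' * \<alpha>' - y' * Q) - \<alpha>' * (N * x * \<alpha> - y * Q') = N * N * A"
    unfolding iso by simp
  have "\<alpha> * (N * x' * \<beta>' + y' * P) - \<beta>' * (N * x * \<alpha> - y * Q')
      = \<alpha> * \<beta>' * (N * (x' - x)) + \<alpha> * y' * P + \<beta>' * y * Q'" by (simp add: algebra_simps)
  also have "\<dots> = N * N * B + P * Q' * ?h"
    unfolding x y y' NN by (simp add: algebra_simps)
  finally show "\<alpha> * (N * x' * \<beta>' + y' * P) - \<beta>' * (N * x * \<alpha> - y * Q') = N * N * B"
    unfolding iso by simp
  have "\<beta> * (N * x' * \<beta>' + y' * P) - \<beta>' * (N * x * \<beta> + y * P')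
      = \<beta> * \<beta>' * (N * (x' - x)) + \<beta> * y' * P - \<beta>' * y * P'" by (simp add: algebra_simps)
  also have "\<dots> = N * N * E - P * P' * ?h"
    unfolding x y y' NN by (simp add: algebra_simps)
  finally show "\<beta> * (N * x' * \<beta>' + y' * P) - \<beta>' * (N * x * \<beta> + y * P') = N * N * E"
    unfolding iso by simp
qed

context imaginary_quadratic
begin

section \<open>From a circle in the family to a matrix\<close>

text \<open>The first column is isotropic and generates an ideal \<open>I\<close>. The second column
  is built with entries in \<open>I\<close>, so the scale factor \<open>N\<close>, the norm of
  \<open>I\<close>, is also the norm of the ideal of all four entries.\<close>

lemma symplectic_matrix:
  assumes B: "B \<in> \<O>" and A: "A = sqrt_discriminant K * of_int m" and E: "E = sqrt_discriminant K * of_int n"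
    and l: "l \<in> K" "A * E + B * cnj B = l * cnj l"
  obtains M where "\<forall>i j. M $ i $ j \<in> K" "ideal_norm K (entries_ideal K M) > 0"
    "M$1$1 * cnj (M$1$2) - cnj (M$1$1) * M$1$2 = of_real (ideal_norm K (entries_ideal K M)) * A"
    "M$1$1 * cnj (M$2$2) - cnj (M$2$1) * M$1$2 = of_real (ideal_norm K (entries_ideal K M)) * B"
    "M$2$1 * cnj (M$2$2) - cnj (M$2$1) * M$2$2 = of_real (ideal_norm K (entries_ideal K M)) * E"
proof -
  have skew: "cnj A = - A" "cnj E = - E"
    unfolding A E by (simp_all add: sqrt_discriminant algebra_simps)
  have AE: "A \<in> \<O>" "E \<in> \<O>"
    unfolding A E sqrt_discriminant by (intro integer_mult integer_diff integer_cnj \<omega>_integer integer_of_int)+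
  obtain \<alpha> \<beta> where K: "\<alpha> \<in> K" "\<beta> \<in> K" and nz: "\<alpha> \<noteq> 0 \<or> \<beta> \<noteq> 0"
    and iso: "\<beta> * cnj \<beta> * A - \<beta> * cnj \<alpha> * B + \<alpha> * cnj \<beta> * cnj B + \<alpha> * cnj \<alpha> * E = 0"
    by (rule isotropic_vector[OF integer_field[OF B] integer_field[OF AE(2)] l(1) skew l(2)])
  define I where "I = {r * \<alpha> + s * \<beta> | r s. r \<in> \<O> \<and> s \<in> \<O>}"
  have I_add: "v + w \<in> I" if "v \<in> I" "w \<in> I" for v w
  proof -
    from that obtain r s r' s' where "v = r * \<alpha> + s * \<beta>" "w = r' * \<alpha> + s' * \<beta>"
      and mem: "r \<in> \<O>" "s \<in> \<O>" "r' \<in> \<O>" "s' \<in> \<O>" unfolding I_def by blast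
    then have "v + w = (r + r') * \<alpha> + (s + s') * \<beta>" by (simp add: algebra_simps)
    then show ?thesis unfolding I_def using mem integer_add by blast
  qed
  have I_mult: "c * v \<in> I" if "c \<in> \<O>" "v \<in> I" for c v
  proof -
    from that obtain r s where "v = r * \<alpha> + s * \<beta>" and mem: "r \<in> \<O>" "s \<in> \<O>"
      unfolding I_def by blast
    then have "c * v = (c * r) * \<alpha> + (c * s) * \<beta>" by (simp add: algebra_simps)
    then show ?thesis unfolding I_def using mem that(1) integer_mult by blast
  qed
  have entries_eq: "entries_ideal K M = I"
    if "M$1$1 = \<alpha>" "M$2$1 = \<beta>" "M$1$2 \<in> I" "M$2$2 \<in> I" for M
  proof
    have "\<alpha> = 1 * \<alpha> + 0 * \<beta>" "\<beta> = 0 * \<alpha> + 1 * \<beta>" by simp_all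
    then have "\<alpha> \<in> I" "\<beta> \<in> I" unfolding I_def using integer_0 integer_1 by blast+
    then show "entries_ideal K M \<subseteq> I"
      unfolding entries_ideal_eq using that I_add I_mult by auto
    show "I \<subseteq> entries_ideal K M"
    proof
      fix v assume "v \<in> I"
      then obtain r s where "v = r * \<alpha> + s * \<beta>" and mem: "r \<in> \<O>" "s \<in> \<O>" unfolding I_def by blast
      then have "v = r * M$1$1 + 0 * M$1$2 + (s * M$2$1 + 0 * M$2$2)" using that by simp
      then show "v \<in> entries_ideal K M" unfolding entries_ideal_eq using mem integer_0 by blast
    qed
  qed
  have I_K: "v \<in> K" if "v \<in> I" for v
  proof -
    from that obtain r s where "v = r * \<alpha> + s * \<beta>" "r \<in> K" "s \<in> K"
      unfolding I_def using integer_field by blast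
    then show ?thesis using K by (simp add: subfield_add subfield_mult subfield)
  qed
  define N where "N = ideal_norm K I"
  have "has_norm I N"
  proof -
    \<comment> \<open>Padding the first column with zeros presents \<open>I\<close> as an ideal of
      entries, to which the norm result applies.\<close>
    define M0 :: "complex^2^2" where "M0 = vector [vector [\<alpha>, 0], vector [\<beta>, 0]]"
    have "0 = 0 * \<alpha> + 0 * \<beta>" by simp
    then have "0 \<in> I" unfolding I_def using integer_0 by blast
    then have I: "entries_ideal K M0 = I" by (intro entries_eq) (simp_all add: M0_def)
    have "\<forall>i j. M0 $ i $ j \<in> K" using K subfield_0[OF subfield] by (simp add: forall_2 M0_def)
    moreover have "M0 $ 1 $ 1 = \<alpha>" "M0 $ 2 $ 1 = \<beta>" by (simp_all add: M0_def)
    then have "\<exists>i j. M0 $ i $ j \<noteq> 0" using nz by metis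
    ultimately show ?thesis using entries_ideal_has_norm[of M0] I unfolding N_def by metis
  qed
  then obtain w1 s1 w2 s2 where N: "N > 0" "\<And>x y. x \<in> I \<Longrightarrow> y \<in> I \<Longrightarrow> x * cnj y / of_real N \<in> \<O>"
    and ws: "w1 \<in> I" "s1 \<in> I" "w2 \<in> I" "s2 \<in> I" and N_eq: "of_real N = w1 * cnj s1 + w2 * cnj s2"
    unfolding has_norm_def by blast
  obtain r1 t1 r2 t2 where w: "w1 = r1 * \<alpha> + t1 * \<beta>" "w2 = r2 * \<alpha> + t2 * \<beta>"
    and rt: "r1 \<in> \<O>" "t1 \<in> \<O>" "r2 \<in> \<O>" "t2 \<in> \<O>"
    using ws(1,3) unfolding I_def by blast
  \<comment> \<open>Writing \<open>w1\<close> and \<open>w2\<close> in terms of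
    \<open>\<alpha>\<close> and \<open>\<beta>\<close> and collecting coefficients in the expression
    for \<open>N\<close> gives \<open>cnj P\<close> and \<open>cnj Q\<close>.\<close>
  define P Q where "P = cnj r1 * s1 + cnj r2 * s2" and "Q = cnj t1 * s1 + cnj t2 * s2"
  have PQ: "P \<in> I" "Q \<in> I"
    unfolding P_def Q_def by (intro I_add I_mult integer_cnj rt ws)+
  have N1: "\<alpha> * cnj P + \<beta> * cnj Q = of_real N"
    unfolding N_eq w P_def Q_def by (simp add: algebra_simps)
  have N2: "cnj \<alpha> * P + cnj \<beta> * Q = of_real N"
    using arg_cong[OF N1, of cnj] by simp
  \<comment> \<open>This value is forced: \<open>y\<close> is the determinant of the matrix sought,
    and it equals the row \<open>(\<beta>, - \<alpha>)\<close> times the given skew-Hermitian matrix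
    times the column \<open>(P, Q)\<close>.\<close>
  define y where "y = \<beta> * A * P + \<beta> * B * Q + \<alpha> * cnj B * P - \<alpha> * E * Q"
  have y': "cnj y = - cnj \<beta> * A * cnj P + cnj \<beta> * cnj B * cnj Q + cnj \<alpha> * B * cnj P + cnj \<alpha> * E * cnj Q"
    unfolding y_def by (simp add: skew)
  \<comment> \<open>Divided by \<open>N\<close>, the right side lies in
    \<open>sqrt \<Delta> * \<int>\<close>: its diagonal terms are integer multiples of
    \<open>A\<close> and \<open>E\<close>, and its mixed terms form an integer minus its conjugate.
    A multiple of \<open>\<omega>\<close> therefore solves for \<open>x\<close>.\<close>
  obtain x where x: "x \<in> \<O>"
    "of_real N * (cnj x - x) = P * cnj P * A + cnj P * Q * B - cnj Q * P * cnj B + Q * cnj Q * E"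
  proof -
    obtain k1 where k1: "P * cnj P / of_real N = of_int k1"
      by (rule real_integer[OF N(2)[OF PQ(1) PQ(1)]]) simp
    obtain k2 where k2: "Q * cnj Q / of_real N = of_int k2"
      by (rule real_integer[OF N(2)[OF PQ(2) PQ(2)]]) simp
    have "Q * cnj P / of_real N * B \<in> \<O>" by (intro integer_mult N(2) PQ B)
    then obtain k3 :: int where k3: "Q * cnj P / of_real N * B - cnj (Q * cnj P / of_real N * B) = sqrt_discriminant K * of_int k3"
      by (rule diff_cnj)
    define x where "x = of_int (- (k1 * m + k2 * n + k3)) * \<omega>"
    have "cnj x - x = sqrt_discriminant K * of_int (k1 * m + k2 * n + k3)"
      by (simp add: x_def sqrt_discriminant algebra_simps)
    also have "\<dots> = P * cnj P / of_real N * A + (Q * cnj P / of_real N * B - cnj (Q * cnj P / of_real N * B))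
        + Q * cnj Q / of_real N * E"
      unfolding k1 k2 k3 A E by (simp add: algebra_simps)
    finally have "of_real N * (cnj x - x) = P * cnj P * A + cnj P * Q * B - cnj Q * P * cnj B + Q * cnj Q * E"
      using N(1) by (simp add: field_simps)
    moreover have "x \<in> \<O>" unfolding x_def by (intro integer_mult integer_of_int \<omega>_integer)
    ultimately show thesis by (rule that[rotated])
  qed
  define \<gamma> \<delta> where "\<gamma> = x * \<alpha> - y * cnj Q / of_real N" and "\<delta> = x * \<beta> + y * cnj P / of_real N"
  \<comment> \<open>Every term of \<open>y\<close> contains \<open>P\<close> or \<open>Q\<close>,
    and these lie in \<open>I\<close>, so their products with \<open>cnj v\<close> are divisible by
    \<open>N\<close>. What remains is a combination of \<open>\<alpha>\<close> and
    \<open>\<beta>\<close> over \<open>\<O>\<close>.\<close>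
  have y_in: "y * cnj v / of_real N \<in> I" if "v \<in> I" for v
  proof -
    have "y * cnj v / of_real N
        = (cnj B * (P * cnj v / of_real N) - E * (Q * cnj v / of_real N)) * \<alpha>
          + (A * (P * cnj v / of_real N) + B * (Q * cnj v / of_real N)) * \<beta>"
      unfolding y_def using N(1) by (simp add: field_simps)
    moreover have "cnj B * (P * cnj v / of_real N) - E * (Q * cnj v / of_real N) \<in> \<O>"
      "A * (P * cnj v / of_real N) + B * (Q * cnj v / of_real N) \<in> \<O>"
      by (intro integer_diff integer_add integer_mult integer_cnj N(2) PQ that AE B)+
    ultimately show ?thesis unfolding I_def by blast
  qed
  have "\<gamma> = x * \<alpha> + 0 * \<beta> + (- 1) * (y * cnj Q / of_real N)" "\<delta> = 0 * \<alpha> + x * \<beta> + y * cnj P / of_real N"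
    by (simp_all add: \<gamma>_def \<delta>_def)
  moreover have "x * \<alpha> + 0 * \<beta> \<in> I" "0 * \<alpha> + x * \<beta> \<in> I"
    unfolding I_def using x(1) integer_0 by blast+
  moreover have "(- 1) * (y * cnj Q / of_real N) \<in> I"
    using I_mult[OF integer_uminus[OF integer_1] y_in[OF PQ(2)]] .
  ultimately have \<gamma>\<delta>: "\<gamma> \<in> I" "\<delta> \<in> I" using I_add y_in[OF PQ(1)] by metis+
  define M :: "complex^2^2" where "M = vector [vector [\<alpha>, \<gamma>], vector [\<beta>, \<delta>]]"
  have M: "M$1$1 = \<alpha>" "M$1$2 = \<gamma>" "M$2$1 = \<beta>" "M$2$2 = \<delta>" by (simp_all add: M_def)
  have ideal: "entries_ideal K M = I" using entries_eq M \<gamma>\<delta> by simp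
  have N0: "complex_of_real N \<noteq> 0" using N(1) by simp
  have \<gamma>\<delta>_eq: "of_real N * x * \<alpha> - y * cnj Q = of_real N * \<gamma>"
    "of_real N * cnj x * cnj \<alpha> - cnj y * Q = of_real N * cnj \<gamma>"
    "of_real N * x * \<beta> + y * cnj P = of_real N * \<delta>"
    "of_real N * cnj x * cnj \<beta> + cnj y * P = of_real N * cnj \<delta>"
    unfolding \<gamma>_def \<delta>_def using N0 by (simp_all add: field_simps)
  note ids = second_column_identities[OF N1 N2 iso y_def y' x(2), unfolded \<gamma>\<delta>_eq]
  have cancel: "u * v' - u' * v = of_real N * c"
    if "u * (of_real N * v') - u' * (of_real N * v) = of_real N * of_real N * c" for u v u' v' c :: complex
  proof -
    have "of_real N * (u * v' - u' * v) = of_real N * (of_real N * c)"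
      using that by (simp add: algebra_simps)
    then show ?thesis using N0 by simp
  qed
  show thesis
  proof (rule that[of M])
    show "\<forall>i j. M $ i $ j \<in> K" using K I_K \<gamma>\<delta> by (simp add: forall_2 M)
    show "ideal_norm K (entries_ideal K M) > 0" using N(1) by (simp add: ideal N_def)
    show "M$1$1 * cnj (M$1$2) - cnj (M$1$1) * M$1$2 = of_real (ideal_norm K (entries_ideal K M)) * A"
      "M$1$1 * cnj (M$2$2) - cnj (M$2$1) * M$1$2 = of_real (ideal_norm K (entries_ideal K M)) * B"
      "M$2$1 * cnj (M$2$2) - cnj (M$2$1) * M$2$2 = of_real (ideal_norm K (entries_ideal K M)) * E"
      unfolding M ideal N_def [symmetric] using ids by (auto intro: cancel)
  qed
qed

lemma circle_family_image:
  assumes D: "D > 0" and l: "l \<in> K" "l * cnj l = of_real D"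
    and C: "C \<in> circle_family K D"
  obtains M where "M \<in> GL2 K" "C = image_of_real_line M"
    "cmod (det M) / ideal_norm K (entries_ideal K M) = sqrt D"
proof -
  have oriented: "C \<in> oriented_circles" using C by (simp add: circle_family_def)
  define s where "s = \<i> * complex_of_real (sqrt D)"
  \<comment> \<open>The sign compensates for the factor \<open>\<i>\<close> in
    \<open>image_of_real_line\<close>: one has \<open>\<i> * (- s) = sqrt D\<close>.\<close>
  define A B E where "A = - (s * of_real (cocurvature C))" and "B = - (s * curvature_center C)"
    and "E = - (s * of_real (curvature C))"
  obtain m n :: int where mn: "s * of_real (cocurvature C) = sqrt_discriminant K * of_int m"
    "s * of_real (curvature C) = sqrt_discriminant K * of_int n" and "s * curvature_center C \<in> \<O>"
    using C unfolding circle_family_iff[OF D oriented] s_def by blast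
  then have B: "B \<in> \<O>" unfolding B_def by (simp add: integer_uminus)
  have A: "A = sqrt_discriminant K * of_int (- m)" and E: "E = sqrt_discriminant K * of_int (- n)"
    unfolding A_def E_def mn by simp_all
  have s: "s * s = - of_real D" "cnj s = - s"
    unfolding s_def using D by (simp_all add: complex_eq_iff)
  have "(cmod (curvature_center C))\<^sup>2 - curvature C * cocurvature C = 1"
    using oriented by (simp add: oriented_circles_def)
  then have rel: "curvature_center C * cnj (curvature_center C) - of_real (curvature C * cocurvature C) = 1"
    by (metis complex_norm_square of_real_1 of_real_diff)
  have "A * E + B * cnj B
      = - (s * s) * (curvature_center C * cnj (curvature_center C) - of_real (curvature C * cocurvature C))"
    unfolding A_def B_def E_def by (simp add: s(2) algebra_simps)
  then have disc: "A * E + B * cnj B = of_real D" unfolding rel s by simp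
  obtain M where M: "\<forall>i j. M $ i $ j \<in> K" and pos: "ideal_norm K (entries_ideal K M) > 0"
    and form: "M$1$1 * cnj (M$1$2) - cnj (M$1$1) * M$1$2 = of_real (ideal_norm K (entries_ideal K M)) * A"
    "M$1$1 * cnj (M$2$2) - cnj (M$2$1) * M$1$2 = of_real (ideal_norm K (entries_ideal K M)) * B"
    "M$2$1 * cnj (M$2$2) - cnj (M$2$1) * M$2$2 = of_real (ideal_norm K (entries_ideal K M)) * E"
    by (rule symplectic_matrix[OF B A E l(1) disc [folded l(2)]])
  define N where "N = ideal_norm K (entries_ideal K M)"
  note pos = pos [folded N_def] and form = form [folded N_def]
  have "complex_of_real ((cmod (det M))\<^sup>2) = det M * cnj (det M)" by (rule complex_norm_square)
  \<comment> \<open>This identity expresses the norm of \<open>det M\<close> through the three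
    expressions that \<open>form\<close> evaluates; by \<open>disc\<close> it becomes
    \<open>N\<^sup>2 * D\<close>.\<close>
  also have "\<dots> = (M$1$1 * cnj (M$2$2) - cnj (M$2$1) * M$1$2) * cnj (M$1$1 * cnj (M$2$2) - cnj (M$2$1) * M$1$2)
      + (M$1$1 * cnj (M$1$2) - cnj (M$1$1) * M$1$2) * (M$2$1 * cnj (M$2$2) - cnj (M$2$1) * M$2$2)"
    by (simp add: det_2 algebra_simps)
  also have "\<dots> = of_real (N * N) * (A * E + B * cnj B)"
    unfolding form by (simp add: algebra_simps)
  also have "\<dots> = of_real ((N * sqrt D)\<^sup>2)"
    unfolding disc using D by (simp add: power_mult_distrib power2_eq_square flip: of_real_mult)
  finally have "(cmod (det M))\<^sup>2 = (N * sqrt D)\<^sup>2" by (simp only: of_real_eq_iff)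
  then have det: "cmod (det M) = N * sqrt D"
    by (rule power2_eq_imp_eq) (use pos D in simp_all)
  have scale: "\<i> * (of_real N * - (s * z)) / of_real (N * sqrt D) = z" for z
    using pos D by (simp add: s_def field_simps)
  show thesis
  proof (rule that)
    show "M \<in> GL2 K" using M det pos D by (auto simp: GL2_def)
    show "cmod (det M) / ideal_norm K (entries_ideal K M) = sqrt D"
      unfolding det N_def [symmetric] using pos by simp
    show "C = image_of_real_line M"
      unfolding image_of_real_line_def Let_def form det A_def B_def E_def scale by simp
  qed
qed

end

theorem theorem3p11:
  fixes K :: "complex set" and D :: real and C :: circle_params
  assumes "imaginary_quadratic_field K"
    and "D \<noteq> 0"
    and "hilbert_symbol D (of_int (field_discriminant K)) = 1"
    and "C \<in> oriented_circles"
  shows "C \<in> circle_family K D \<longleftrightarrow>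
    (\<exists>P \<in> PGL2 K. \<exists>M \<in> P. C = image_of_real_line M \<and>
       cmod (det M) / ideal_norm K (entries_ideal K M) = sqrt D)"
proof -
  interpret imaginary_quadratic K by unfold_locales fact
  obtain l where l: "l \<in> K" "l * cnj l = of_real D"
    using norm_form[OF assms(2,3)] .
  \<comment> \<open>Being a nonzero norm from \<open>K\<close>, the number \<open>D\<close> is
    positive, so \<open>sqrt D\<close> is a positive real root.\<close>
  have "complex_of_real D = of_real ((cmod l)\<^sup>2)" unfolding l(2) [symmetric] by (rule complex_norm_square [symmetric])
  then have "D = (cmod l)\<^sup>2" by (simp only: of_real_eq_iff)
  then have D: "D > 0" using assms(2) by simp
  show ?thesis
  proof
    assume "C \<in> circle_family K D"
    then obtain M where M: "M \<in> GL2 K" "C = image_of_real_line M"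
      "cmod (det M) / ideal_norm K (entries_ideal K M) = sqrt D"
      by (rule circle_family_image[OF D l])
    have "(M, M) \<in> proportional K"
      unfolding proportional_def using M(1) subfield_1[OF subfield]
      by (auto intro!: bexI[of _ 1] simp: vec_eq_iff)
    \<comment> \<open>The matrix found represents its own class, so the class of \<open>M\<close>
      serves as \<open>P\<close>.\<close>
    then have "M \<in> proportional K `` {M}" by blast
    moreover have "proportional K `` {M} \<in> PGL2 K"
      unfolding PGL2_def using M(1) by (rule quotientI)
    ultimately show "\<exists>P\<in>PGL2 K. \<exists>M\<in>P. C = image_of_real_line M \<and>
        cmod (det M) / ideal_norm K (entries_ideal K M) = sqrt D"
      using M by blast
  next
    assume "\<exists>P\<in>PGL2 K. \<exists>M\<in>P. C = image_of_real_line M \<and>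
        cmod (det M) / ideal_norm K (entries_ideal K M) = sqrt D"
    then obtain P M where "P \<in> PGL2 K" "M \<in> P" and M: "C = image_of_real_line M"
      "cmod (det M) / ideal_norm K (entries_ideal K M) = sqrt D" by blast
    then have "M \<in> GL2 K" by (auto simp: PGL2_def quotient_def proportional_def)
    then show "C \<in> circle_family K D"
      unfolding M(1) by (rule image_in_circle_family[OF D _ M(2)])
  qed
qed

end
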